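(* (i) If $(Y_t)$ is a covariance-stationary process having a spectral density $f$ satisfying $f(\lambda)\sim c_f|\lambda|$ as $\lambda\to0$, for some $c_f>0$, then $$\mathrm{Var}(Y_1+\cdots+Y_n)\sim4c_f\log(n),\qquad n\to\infty.$$ (ii) If $(Y_t)$ is a stationary linear process with memory parameter $d=-1/2$, that is, $Y_t=\mu+\sum_{j=0}^\infty a_j\epsilon_{t-j}$ with $\mu\in\mathbb{R}$, $(\epsilon_t)_{t\in\mathbb{Z}}$ i.i.d. with zero mean, variance $\sigma_\epsilon^2>0$ and finite fourth moment, and real coefficients satisfying $\sum_{j=0}^\infty a_j=0$ and $a_j=c(-1/2)\,j^{-3/2}(1+O(j^{-1}))$ with $c(-1/2)\ne0$, then the spectral density of $(Y_t)$ satisfies $$f(\lambda)\sim c_f|\lambda|\quad\text{as }\lambda\to0,\qquad c_f=2\sigma_\epsilon^2c(-1/2)^2,$$ and therefore $$\mathrm{Var}(Y_1+\cdots+Y_n)\sim\delta(-1/2)\log(n),\qquad n\to\infty,\qquad\text{where }\delta(-1/2)=8\sigma_\epsilon^2c(-1/2)^2.$$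
   Context: The spectral density $f$ of a covariance-stationary process $(Y_t)$ is normalized by $\mathrm{Cov}(Y_0,Y_h)=\int_{-\pi}^{\pi}e^{\mathrm{i}h\lambda}f(\lambda)\,d\lambda$, $h\in\mathbb{Z}$. The notation $a_n\sim b_n$ means $a_n/b_n\to1$. *)

theory Defs
  imports "HOL-Probability.Probability" "HOL-Library.Landau_Symbols"
begin

definition (in prob_space) covariance :: "('a \<Rightarrow> real) \<Rightarrow> ('a \<Rightarrow> real) \<Rightarrow> real" where
  "covariance X Y = expectation (\<lambda>\<omega>. (X \<omega> - expectation X) * (Y \<omega> - expectation Y))"

definition (in prob_space) covariance_stationary :: "(int \<Rightarrow> 'a \<Rightarrow> real) \<Rightarrow> bool" where
  "covariance_stationary Y \<longleftrightarrow>
     (\<forall>t. random_variable borel (Y t) \<and> integrable M (\<lambda>\<omega>. (Y t \<omega>)\<^sup>2)) \<and>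
     (\<forall>t. expectation (Y t) = expectation (Y 0)) \<and>
     (\<forall>t h. covariance (Y t) (Y (t + h)) = covariance (Y 0) (Y h))"

text \<open>
  Only the values on \<open>[-\<pi>, \<pi>]\<close> matter; no periodicity is imposed, and nonnegative modifications on null sets
  of a spectral density are again spectral densities.
\<close>
definition (in prob_space) spectral_density :: "(int \<Rightarrow> 'a \<Rightarrow> real) \<Rightarrow> (real \<Rightarrow> real) \<Rightarrow> bool" where
  "spectral_density Y f \<longleftrightarrow>
     (\<forall>x\<in>{-pi..pi}. 0 \<le> f x) \<and>
     set_integrable lebesgue {-pi..pi} f \<and>
     (\<forall>h. complex_of_real (covariance (Y 0) (Y h)) =
        (LINT x:{-pi..pi}|lebesgue. exp (\<i> * of_int h * of_real x) * of_real (f x)))"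

definition (in prob_space) iid :: "(int \<Rightarrow> 'a \<Rightarrow> real) \<Rightarrow> bool" where
  "iid \<epsilon> \<longleftrightarrow> indep_vars (\<lambda>_. borel) \<epsilon> UNIV \<and> (\<forall>t. distr M borel (\<epsilon> t) = distr M borel (\<epsilon> 0))"

text \<open>
  \<open>Y\<^sub>t = \<mu> + \<Sum>\<^sub>j a\<^sub>j \<epsilon>\<^bsub>t-j\<^esub>\<close>, the series converging almost surely. Measurability of \<open>Y t\<close> is required
  separately because \<open>M\<close> need not be complete.
\<close>
definition (in prob_space) linear_process ::
    "real \<Rightarrow> (nat \<Rightarrow> real) \<Rightarrow> (int \<Rightarrow> 'a \<Rightarrow> real) \<Rightarrow> (int \<Rightarrow> 'a \<Rightarrow> real) \<Rightarrow> bool" where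
  "linear_process \<mu> a \<epsilon> Y \<longleftrightarrow>
     (\<forall>t. random_variable borel (Y t) \<and>
          (AE \<omega> in M. (\<lambda>j. a j * \<epsilon> (t - int j) \<omega>) sums (Y t \<omega> - \<mu>)))"

text \<open>
  The coefficient conditions for memory parameter \<open>d = -1/2\<close>, with \<open>c\<close> in the role of \<open>c(-1/2)\<close>.
  The relation for \<open>a\<^sub>j\<close> is read for \<open>j \<ge> 1\<close>; \<open>a\<^sub>0\<close> is then determined by the vanishing sum.
\<close>
definition memory_minus_half :: "real \<Rightarrow> (nat \<Rightarrow> real) \<Rightarrow> bool" where
  "memory_minus_half c a \<longleftrightarrow>
     c \<noteq> 0 \<and> a sums 0 \<and>
     (\<exists>r. r \<in> O(\<lambda>j. 1 / real j) \<and> (\<forall>j\<ge>1. a j = c * real j powr (-3/2) * (1 + r j)))"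

end

theory Submission
  imports Defs
begin

text \<open>
  Write \<open>K\<^sub>n x = \<bar>\<Sum>\<^bsub>t\<le>n\<^esub> e\<^sup>i\<^sup>t\<^sup>x\<bar>\<^sup>2\<close>, that is, \<open>n\<close> times the Fejer kernel. Expanding the square gives
  \<open>Var (Y\<^sub>1 + \<dots> + Y\<^sub>n) = \<integral> K\<^sub>n f\<close> over \<open>[-\<pi>, \<pi>]\<close> (\<open>variance_sum_spectral\<close>). Off a neighbourhood of \<open>0\<close> the kernel is
  bounded uniformly in \<open>n\<close>, so that only the behaviour of \<open>f\<close> at \<open>0\<close> matters as soon as the integral tends to
  infinity. There \<open>f\<close> may be replaced by any function that is asymptotic to it, and the convenient one is
  \<open>c\<^sub>f \<cdot> 2 \<bar>sin (x/2)\<bar>\<close> instead of \<open>c\<^sub>f \<bar>x\<bar>\<close>: with this weight the increments in \<open>n\<close> of the integral are elementary,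
  and the integral is exactly \<open>c\<^sub>f \<Sum>\<^bsub>k<n\<^esub> 8 / (2k + 1)\<close> (\<open>has_integral_dirichlet_kernel_sq\<close>), which is asymptotic to
  \<open>4 c\<^sub>f log n\<close>. This is the first part (\<open>dirichlet_kernel_integral_asymp\<close>).

  For the second part, let \<open>A x = \<Sum>\<^sub>j a\<^sub>j e\<^sup>i\<^sup>j\<^sup>x\<close>. The partial sums of the linear process converge in mean square, so
  that the covariances are limits of \<open>\<sigma>\<^sup>2 \<Sum> a\<^sub>j a\<^sub>k\<close> over \<open>j, k < N\<close> with \<open>k = h + j\<close>; the Fourier
  coefficients of \<open>\<sigma>\<^sup>2 / (2\<pi>) \<bar>A\<bar>\<^sup>2\<close> are limits of the very same sums. Hence this function is a spectral density, and
  by the uniqueness of Fourier coefficients the only one up to null sets (\<open>spectral_density_unique\<close>).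

  The behaviour of \<open>A\<close> at \<open>0\<close> comes from a comparison with the binomial series
  \<open>B(z) = \<Sum>\<^sub>j b\<^sub>j z\<^sup>j\<close> of the square root of \<open>1 - z\<close>. Its coefficients satisfy
  \<open>b\<^sub>j = - j\<^bsup>-3/2\<^esup> (1 + O(1/j)) / (2 \<surd>\<pi>)\<close> (\<open>sqrt_coeff_asymp\<close>), and \<open>B(z)\<^sup>2 = 1 - z\<close> on the whole closed disc, so
  \<open>\<bar>B(e\<^sup>i\<^sup>x)\<bar>\<^sup>2 = 2 \<bar>sin (x/2)\<bar>\<close> and \<open>B(1) = 0\<close>. The coefficients \<open>d\<^sub>j = a\<^sub>j + 2 \<surd>\<pi> c b\<^sub>j\<close> are then
  \<open>O(j\<^bsup>-5/2\<^esup>)\<close> and sum to \<open>0\<close>, whence \<open>\<Sum>\<^sub>j d\<^sub>j e\<^sup>i\<^sup>j\<^sup>x = O(x)\<close>. This is negligible against \<open>\<bar>x\<bar>\<^bsup>1/2\<^esup>\<close>, and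
  \<open>\<bar>A x\<bar>\<^sup>2\<close> is asymptotic to \<open>4 \<pi> c\<^sup>2 \<bar>x\<bar>\<close> (\<open>transfer_function_asymp\<close>).
\<close>

section \<open>A multiple of the Fejer kernel\<close>

lemma two_abs_sin_half_asymp: "((\<lambda>x. 2 * \<bar>sin (x / 2)\<bar> / \<bar>x\<bar>) \<longlongrightarrow> 1) (at (0::real))"
proof -
  have "((\<lambda>x. sin x / x) \<longlongrightarrow> 1) (at (0::real))"
    using DERIV_sin[of 0] by (simp add: has_field_derivative_iff)
  moreover have "LIM x (at 0). (x::real) / 2 :> at 0"
    by (rule filterlim_atI) (auto intro!: tendsto_eq_intros simp: eventually_at_filter)
  ultimately have "((\<lambda>x. sin (x / 2) / (x / 2)) \<longlongrightarrow> 1) (at (0::real))"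
    by (rule filterlim_compose)
  hence "((\<lambda>x. \<bar>sin (x / 2) / (x / 2)\<bar>) \<longlongrightarrow> \<bar>1\<bar>) (at (0::real))"
    by (rule tendsto_rabs)
  moreover have "\<bar>sin (x / 2) / (x / 2)\<bar> = 2 * \<bar>sin (x / 2)\<bar> / \<bar>x\<bar>" for x :: real
    by (simp add: abs_divide abs_mult mult.commute)
  ultimately show ?thesis by (simp only: abs_one)
qed

text \<open>
  Up to the factor \<open>n\<close> this is the Fejer kernel; the indices \<open>1, \<dots>, n\<close> are those of the partial sums of the process.
\<close>
definition dirichlet_kernel_sq :: "nat \<Rightarrow> real \<Rightarrow> real" where
  "dirichlet_kernel_sq n x = (cmod (\<Sum>t=1..n. cis (real t * x)))\<^sup>2"

lemma dirichlet_kernel_sq_nonneg [simp]: "0 \<le> dirichlet_kernel_sq n x"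
  by (simp add: dirichlet_kernel_sq_def)

lemma continuous_on_dirichlet_kernel_sq [continuous_intros]:
  "continuous_on A (dirichlet_kernel_sq n)"
  unfolding dirichlet_kernel_sq_def cis_conv_exp by (intro continuous_intros)

lemma cmod_one_minus_cis: "(cmod (1 - cis x))\<^sup>2 = (2 * sin (x / 2))\<^sup>2"
proof -
  have "cos x = 1 - 2 * (sin (x / 2))\<^sup>2"
    using cos_double_sin[of "x / 2"] by simp
  moreover have "(cmod (1 - cis x))\<^sup>2 = (1 - cos x)\<^sup>2 + (sin x)\<^sup>2"
    by (simp add: cmod_power2)
  moreover have "(1 - cos x)\<^sup>2 + (sin x)\<^sup>2 = 2 - 2 * cos x"
    using sin_cos_squared_add[of x] by (simp add: power2_eq_square algebra_simps)
  ultimately show ?thesis by (simp add: power_mult_distrib)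
qed

lemma cmod_one_minus_cis_abs: "cmod (1 - cis x) = 2 * \<bar>sin (x / 2)\<bar>"
  by (rule power2_eq_imp_eq) (simp_all add: cmod_one_minus_cis power_mult_distrib)

text \<open>
  The geometric sum, cleared of its denominator so that it also holds where \<open>sin (x / 2)\<close> vanishes.
\<close>
lemma sin_sq_times_dirichlet_kernel_sq:
  "(2 * sin (x / 2))\<^sup>2 * dirichlet_kernel_sq n x = (2 * sin (real n * x / 2))\<^sup>2"
proof -
  have "(1 - cis x) * (\<Sum>t=1..n. cis (real t * x)) = cis x * (1 - cis (real n * x))"
  proof (induction n)
    case (Suc n)
    have "(1 - cis x) * (\<Sum>t=1..Suc n. cis (real t * x))
       = cis x * (1 - cis (real n * x)) + (1 - cis x) * cis (real (Suc n) * x)"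
      using Suc by (simp add: distrib_left)
    also have "\<dots> = cis x * (1 - cis (real (Suc n) * x))"
      by (simp add: algebra_simps cis_mult)
    finally show ?case .
  qed simp
  hence "cmod (1 - cis x) * cmod (\<Sum>t=1..n. cis (real t * x)) = cmod (1 - cis (real n * x))"
    by (metis norm_mult norm_cis mult_1)
  thus ?thesis
    unfolding dirichlet_kernel_sq_def cmod_one_minus_cis[symmetric]
    by (metis power_mult_distrib)
qed

text \<open>
  By the closed form, the increment of the kernel is the Dirichlet kernel \<open>sin ((n + 1/2) x) / sin (x / 2)\<close>. The weight
  \<open>2 sin (x / 2)\<close> therefore turns the increment into a pure sine.
\<close>
lemma dirichlet_kernel_sq_Suc_diff:
  assumes "0 \<le> x" "x \<le> pi"
  shows "(dirichlet_kernel_sq (Suc n) x - dirichlet_kernel_sq n x) * (2 * sin (x / 2))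
     = 2 * sin ((real n + 1 / 2) * x)"
proof (cases "x = 0")
  case False
  hence s: "sin (x / 2) > 0" using assms by (intro sin_gt_zero) auto
  have "(2 * sin (x / 2))\<^sup>2 * (dirichlet_kernel_sq (Suc n) x - dirichlet_kernel_sq n x)
     = (2 * sin (real (Suc n) * x / 2))\<^sup>2 - (2 * sin (real n * x / 2))\<^sup>2"
    by (simp only: right_diff_distrib sin_sq_times_dirichlet_kernel_sq)
  also have "\<dots> = (2 * sin (x / 2)) * (2 * sin ((real n + 1 / 2) * x))"
  proof -
    have e: "real (Suc n) * x / 2 = real n * x / 2 + x / 2"
      "(real n + 1 / 2) * x = real n * x / 2 + (real n * x / 2 + x / 2)" by (simp_all add: field_simps)
    define u v where "u = real n * x / 2" and "v = x / 2"
    have cs: "(cos u)\<^sup>2 = 1 - (sin u)\<^sup>2" "(cos v)\<^sup>2 = 1 - (sin v)\<^sup>2"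
      by (simp_all add: cos_squared_eq)
    have "(2 * sin (u + v))\<^sup>2 - (2 * sin u)\<^sup>2 = (2 * sin v) * (2 * sin (u + (u + v)))"
      using cs unfolding sin_add cos_add by algebra
    thus ?thesis unfolding e u_def v_def .
  qed
  finally have "(2 * sin (x / 2)) * ((dirichlet_kernel_sq (Suc n) x - dirichlet_kernel_sq n x) * (2 * sin (x / 2)))
     = (2 * sin (x / 2)) * (2 * sin ((real n + 1 / 2) * x))"
    by (simp only: power2_eq_square mult_ac)
  thus ?thesis using s by simp
qed simp

text \<open>
  Induction on \<open>n\<close>: the sine of the increment integrates to \<open>4 / (2n + 1)\<close>, as \<open>cos ((n + 1/2) \<pi>) = 0\<close>.
\<close>
lemma has_integral_dirichlet_kernel_sq_half:
  "((\<lambda>x. dirichlet_kernel_sq n x * (2 * \<bar>sin (x / 2)\<bar>)) has_integral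
      (\<Sum>k<n. 4 / (2 * real k + 1))) {0..pi}"
proof (induction n)
  case 0
  show ?case by (simp add: dirichlet_kernel_sq_def)
next
  case (Suc n)
  have "((\<lambda>x. 2 * sin ((real n + 1 / 2) * x)) has_integral
      (- 2 * cos ((real n + 1 / 2) * pi) / (real n + 1 / 2) - (- 2 * cos ((real n + 1 / 2) * 0) / (real n + 1 / 2)))) {0..pi}"
    by (intro fundamental_theorem_of_calculus)
      (auto intro!: derivative_eq_intros simp: has_real_derivative_iff_has_vector_derivative[symmetric])
  moreover have "cos ((real n + 1 / 2) * pi) = 0"
    by (simp add: distrib_right cos_add)
  moreover from this have "- 2 * cos ((real n + 1 / 2) * pi) / (real n + 1 / 2) - (- 2 * cos ((real n + 1 / 2) * 0) / (real n + 1 / 2))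
      = 4 / (2 * real n + 1)"
    by (simp add: divide_simps)
  ultimately have "((\<lambda>x. 2 * sin ((real n + 1 / 2) * x)) has_integral (4 / (2 * real n + 1))) {0..pi}"
    by simp
  from has_integral_add[OF Suc this]
  have "((\<lambda>x. dirichlet_kernel_sq n x * (2 * \<bar>sin (x / 2)\<bar>) + 2 * sin ((real n + 1 / 2) * x))
      has_integral (\<Sum>k<Suc n. 4 / (2 * real k + 1))) {0..pi}" by simp
  thus ?case
  proof (rule has_integral_eq[rotated])
    fix x :: real assume x: "x \<in> {0..pi}"
    hence "sin (x / 2) \<ge> 0" by (intro sin_ge_zero) auto
    thus "dirichlet_kernel_sq n x * (2 * \<bar>sin (x / 2)\<bar>) + 2 * sin ((real n + 1 / 2) * x)
        = dirichlet_kernel_sq (Suc n) x * (2 * \<bar>sin (x / 2)\<bar>)"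
      using dirichlet_kernel_sq_Suc_diff[of x n] x by (simp add: left_diff_distrib)
  qed
qed

lemma dirichlet_kernel_sq_minus [simp]: "dirichlet_kernel_sq n (- x) = dirichlet_kernel_sq n x"
proof -
  have "(\<Sum>t=1..n. cis (real t * (- x))) = cnj (\<Sum>t=1..n. cis (real t * x))"
    by (simp add: cis_cnj)
  thus ?thesis unfolding dirichlet_kernel_sq_def by (metis complex_mod_cnj)
qed

lemma has_integral_dirichlet_kernel_sq:
  "((\<lambda>x. dirichlet_kernel_sq n x * (2 * \<bar>sin (x / 2)\<bar>)) has_integral
      (\<Sum>k<n. 8 / (2 * real k + 1))) {-pi..pi}"
proof -
  let ?g = "\<lambda>x. dirichlet_kernel_sq n x * (2 * \<bar>sin (x / 2)\<bar>)"
  have "(?g has_integral (\<Sum>k<n. 4 / (2 * real k + 1))) {-pi..-0}"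
    using has_integral_reflect_real[of ?g "\<Sum>k<n. 4 / (2 * real k + 1)" pi 0]
      has_integral_dirichlet_kernel_sq_half[of n] by simp
  hence "(?g has_integral ((\<Sum>k<n. 4 / (2 * real k + 1)) + (\<Sum>k<n. 4 / (2 * real k + 1)))) {-pi..pi}"
    using has_integral_dirichlet_kernel_sq_half[of n]
    by (intro has_integral_combine[of "-pi" 0 pi]) auto
  thus ?thesis by (simp add: sum.distrib[symmetric])
qed

text \<open>
  Comparing \<open>8 / (2k + 1)\<close> with \<open>4 / (k + 1)\<close> from below and with \<open>4 / k\<close> from above sandwiches the sum between harmonic
  sums.
\<close>
lemma odd_harmonic_sum_asymp: "(\<lambda>n. \<Sum>k<n. 8 / (2 * real k + 1)) \<sim>[at_top] (\<lambda>n. 4 * ln (real n))"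
proof (rule asymp_equiv_sandwich_real)
  have upper: "(\<Sum>k<n. 8 / (2 * real k + 1)) \<le> 8 + 4 * harm n" for n
  proof -
    have "(\<Sum>k<Suc j. 8 / (2 * real k + 1)) \<le> 8 + 4 * harm j" for j
    proof (induction j)
      case (Suc j)
      have "8 / (2 * real (Suc j) + 1) \<le> 4 * inverse (real (Suc j))" by (simp add: field_simps)
      thus ?case using Suc by (simp add: harm_Suc)
    qed (simp add: harm_def)
    from this[of n] show ?thesis by simp (smt (verit) divide_nonneg_nonneg of_nat_0_le_iff)
  qed
  have lower: "4 * harm n \<le> (\<Sum>k<n. 8 / (2 * real k + 1))" for n
  proof (induction n)
    case (Suc n)
    have "4 * inverse (real (Suc n)) \<le> 8 / (2 * real n + 1)" by (simp add: field_simps)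
    thus ?case using Suc by (simp add: harm_Suc)
  qed (simp add: harm_def)
  show "\<forall>\<^sub>F n in sequentially. (\<Sum>k<n. 8 / (2 * real k + 1)) \<in> {4 * harm n..8 + 4 * harm n}"
    using upper lower by simp
  have h: "(\<lambda>n. harm n - ln (real n)) \<longlonglongrightarrow> euler_mascheroni"
    by (rule euler_mascheroni_LIMSEQ)
  have l: "LIM n sequentially. ln (real n) :> at_top"
    by (intro filterlim_compose[OF ln_at_top] filterlim_real_sequentially)
  have q: "(\<lambda>n. c / ln (real n) + ((harm n - ln (real n)) / ln (real n) + 1)) \<longlonglongrightarrow> 0 + (0 + 1)" for c :: real
    by (intro tendsto_add tendsto_const tendsto_divide_0[OF tendsto_const] tendsto_divide_0[OF h]
        filterlim_at_top_imp_at_infinity l)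
  have ev: "\<forall>\<^sub>F n in sequentially. c / ln (real n) + ((harm n - ln (real n)) / ln (real n) + 1) = (4*c + 4 * harm n) / (4 * ln (real n))"
    for c :: real
    using eventually_gt_at_top[of 1] by eventually_elim (simp add: field_simps)
  show "(\<lambda>n. 4 * harm n) \<sim>[at_top] (\<lambda>n. 4 * ln (real n))"
    using Lim_transform_eventually[OF q ev, of 0] by (intro asymp_equivI') simp
  show "(\<lambda>n. 8 + 4 * harm n) \<sim>[at_top] (\<lambda>n. 4 * ln (real n))"
    using Lim_transform_eventually[OF q ev, of 2] by (intro asymp_equivI') simp
qed

section \<open>The variance of partial sums\<close>

lemma absolutely_integrable_continuous_mult:
  fixes g h :: "real \<Rightarrow> 'b::{euclidean_space, real_normed_algebra}"
  assumes "continuous_on {a..b} g" "h absolutely_integrable_on {a..b}"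
  shows "(\<lambda>x. g x * h x) absolutely_integrable_on {a..b}"
proof (rule absolutely_integrable_bounded_measurable_product[where h="\<lambda>x y. x * y" and f=g and g=h, OF _ _ _ _ assms(2)])
  show "bilinear (\<lambda>x y :: 'b. x * y)" by (rule bilinear_times)
  show "g \<in> borel_measurable (lebesgue_on {a..b})"
    using assms(1) by (intro continuous_imp_measurable_on_sets_lebesgue) auto
  show "bounded (g ` {a..b})"
    using assms(1) by (intro compact_imp_bounded compact_continuous_image) auto
qed simp

lemma absolutely_integrable_of_real:
  assumes "f absolutely_integrable_on S"
  shows "(\<lambda>x. complex_of_real (f x)) absolutely_integrable_on S"
proof -
  have "(\<lambda>x. indicator S x *\<^sub>R complex_of_real (f x)) = (\<lambda>x. complex_of_real (indicator S x *\<^sub>R f x))"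
    by (auto simp: indicator_def fun_eq_iff)
  thus ?thesis using assms unfolding set_integrable_def by (metis integrable_of_real)
qed

text \<open>
  Given \<open>\<epsilon>\<close>, on \<open>0 < \<bar>x\<bar> < r\<close> the function \<open>f\<close> differs from \<open>c \<cdot> 2 \<bar>sin (x/2)\<bar>\<close> by at most \<open>\<epsilon> \<cdot> 2 \<bar>sin (x/2)\<bar>\<close>, and
  for \<open>r \<le> \<bar>x\<bar> \<le> \<pi>\<close> the kernel is at most \<open>4 / (2 sin (r/2))\<^sup>2\<close>. Hence the two integrals differ by at most \<open>\<epsilon>\<close> times the
  explicit one plus a constant, and the explicit one tends to infinity.
\<close>
lemma dirichlet_kernel_integral_asymp:
  fixes f :: "real \<Rightarrow> real"
  assumes f: "f absolutely_integrable_on {-pi..pi}" and c: "c > 0"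
    and lim: "f \<sim>[at 0] (\<lambda>x. c * \<bar>x\<bar>)"
  shows "(\<lambda>n. LINT x:{-pi..pi}|lebesgue. dirichlet_kernel_sq n x * f x) \<sim>[at_top] (\<lambda>n. 4 * c * ln (real n))"
proof -
  define w where "w = (\<lambda>x::real. 2 * \<bar>sin (x / 2)\<bar>)"
  define J where "J = (\<lambda>n. \<Sum>k<n. 8 / (2 * real k + 1))"
  define I where "I = (\<lambda>n. LINT x:{-pi..pi}|lebesgue. dirichlet_kernel_sq n x * f x)"
  have cw: "continuous_on {-pi..pi} w" unfolding w_def by (intro continuous_intros) auto
  have wi: "w absolutely_integrable_on {-pi..pi}"
    by (rule absolutely_integrable_continuous_real[OF cw])
  have Kwi: "(\<lambda>x. dirichlet_kernel_sq n x * w x) absolutely_integrable_on {-pi..pi}" for n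
    by (intro absolutely_integrable_continuous_mult wi continuous_on_dirichlet_kernel_sq)
  have Kfi: "(\<lambda>x. dirichlet_kernel_sq n x * f x) absolutely_integrable_on {-pi..pi}" for n
    by (intro absolutely_integrable_continuous_mult f continuous_on_dirichlet_kernel_sq)
  have J: "(LINT x:{-pi..pi}|lebesgue. dirichlet_kernel_sq n x * w x) = J n" for n
    using has_integral_dirichlet_kernel_sq[of n]
    unfolding set_lebesgue_integral_eq_integral(2)[OF Kwi] unfolding w_def J_def by (rule integral_unique)
  have "((\<lambda>x. w x / \<bar>x\<bar>) \<longlongrightarrow> 1) (at (0::real))"
    unfolding w_def by (rule two_abs_sin_half_asymp)
  hence "w \<sim>[at 0] (\<lambda>x. \<bar>x\<bar>)" by (rule asymp_equivI')
  hence "(\<lambda>x. c * w x) \<sim>[at 0] (\<lambda>x. c * \<bar>x\<bar>)" by (intro asymp_equiv_intros) auto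
  hence "f \<sim>[at 0] (\<lambda>x. c * w x)" using lim asymp_equiv_sym asymp_equiv_trans by blast
  hence small: "(\<lambda>x. f x - c * w x) \<in> o[at 0](\<lambda>x. c * w x)" by (rule asymp_equiv_imp_diff_smallo)
  have bound: "\<exists>C. \<forall>n. \<bar>I n - c * J n\<bar> \<le> \<epsilon> * J n + C" if "\<epsilon> > 0" for \<epsilon>
  proof -
    from landau_o.smallD[OF small, of "\<epsilon> / c"] c that
    have "\<forall>\<^sub>F x in at 0. \<bar>f x - c * w x\<bar> \<le> \<epsilon> * w x"
      by (simp add: w_def abs_mult)
    then obtain d where d: "d > 0" "\<And>x. x \<noteq> 0 \<Longrightarrow> \<bar>x\<bar> < d \<Longrightarrow> \<bar>f x - c * w x\<bar> \<le> \<epsilon> * w x"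
      unfolding eventually_at by (auto simp: dist_real_def)
    \<comment> \<open>Capping at \<open>\<pi>\<close> keeps \<open>r / 2\<close> where the sine is increasing.\<close>
    define r where "r = min d pi"
    have r: "0 < r" "r \<le> pi" "\<And>x. x \<noteq> 0 \<Longrightarrow> \<bar>x\<bar> < r \<Longrightarrow> \<bar>f x - c * w x\<bar> \<le> \<epsilon> * w x"
      using d by (auto simp: r_def)
    define B where "B = 4 / (2 * sin (r / 2))\<^sup>2"
    have sr: "sin (r / 2) > 0" using r by (intro sin_gt_zero) auto
    have B0: "B \<ge> 0" by (simp add: B_def)
    have KB: "dirichlet_kernel_sq n x \<le> B" if "\<bar>x\<bar> \<ge> r" "\<bar>x\<bar> \<le> pi" for n x
    proof -
      have "sin (r / 2) \<le> sin (\<bar>x\<bar> / 2)" using that r by (intro sin_monotone_2pi_le) auto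
      also have "\<dots> \<le> \<bar>sin (x / 2)\<bar>" by (cases "x \<ge> 0") (auto simp: abs_if)
      finally have "(sin (r / 2))\<^sup>2 \<le> (sin (x / 2))\<^sup>2" using sr
        by (metis less_imp_le power2_abs power_mono)
      hence "(2 * sin (r / 2))\<^sup>2 * dirichlet_kernel_sq n x \<le> (2 * sin (x / 2))\<^sup>2 * dirichlet_kernel_sq n x"
        by (intro mult_right_mono) (auto simp: power_mult_distrib)
      also have "\<dots> \<le> 4"
        unfolding sin_sq_times_dirichlet_kernel_sq by (simp add: power_mult_distrib abs_square_le_1)
      finally show ?thesis using sr by (simp add: B_def field_simps)
    qed
    define h where "h = (\<lambda>x. \<bar>f x - c * w x\<bar>)"
    have fw: "(\<lambda>x. f x - c * w x) absolutely_integrable_on {-pi..pi}"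
      using set_integral_diff(1)[OF f, of "\<lambda>x. c * w x"] wi by (simp add: set_integrable_mult_right)
    have hi: "h absolutely_integrable_on {-pi..pi}"
      using set_integrable_norm[OF fw] by (simp add: h_def)
    have Ki: "(\<lambda>x. dirichlet_kernel_sq n x * (f x - c * w x)) absolutely_integrable_on {-pi..pi}" for n
      by (intro absolutely_integrable_continuous_mult fw continuous_on_dirichlet_kernel_sq)
    have "\<bar>I n - c * J n\<bar> \<le> \<epsilon> * J n + B * (LINT x:{-pi..pi}|lebesgue. h x)" for n
    proof -
      have eq: "I n - c * J n = (LINT x:{-pi..pi}|lebesgue. dirichlet_kernel_sq n x * (f x - c * w x))"
        unfolding I_def J[symmetric] using set_integral_diff(2)[OF Kfi[of n] set_integrable_mult_right[OF _, OF Kwi[of n]], of c]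
        by (simp add: algebra_simps)
      have "\<bar>I n - c * J n\<bar> \<le> (LINT x:{-pi..pi}|lebesgue. \<bar>dirichlet_kernel_sq n x * (f x - c * w x)\<bar>)"
        unfolding eq using set_integral_norm_bound[OF Ki[of n]] by simp
      also have "\<dots> \<le> (LINT x:{-pi..pi}|lebesgue. \<epsilon> * (dirichlet_kernel_sq n x * w x) + B * h x)"
      proof (rule set_integral_mono_AE)
        show "(\<lambda>x. \<bar>dirichlet_kernel_sq n x * (f x - c * w x)\<bar>) absolutely_integrable_on {-pi..pi}"
          using set_integrable_norm[OF Ki[of n]] by simp
        show "(\<lambda>x. \<epsilon> * (dirichlet_kernel_sq n x * w x) + B * h x) absolutely_integrable_on {-pi..pi}"
          by (intro set_integral_add(1) set_integrable_mult_right Kwi hi)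
        \<comment> \<open>The asymptotics at \<open>0\<close> say nothing about the value \<open>f 0\<close>.\<close>
        have "AE x in lebesgue. x \<noteq> (0::real)"
          by (rule AE_not_in[of "{0}", simplified]) (simp add: negligible_iff_null_sets[symmetric])
        thus "AE x in lebesgue. x \<in> {-pi..pi} \<longrightarrow> \<bar>dirichlet_kernel_sq n x * (f x - c * w x)\<bar>
            \<le> \<epsilon> * (dirichlet_kernel_sq n x * w x) + B * h x"
        proof eventually_elim
          case (elim x)
          show ?case
          proof (intro impI)
            assume x: "x \<in> {-pi..pi}"
            show "\<bar>dirichlet_kernel_sq n x * (f x - c * w x)\<bar> \<le> \<epsilon> * (dirichlet_kernel_sq n x * w x) + B * h x"
            proof (cases "\<bar>x\<bar> < r")
              case True
              have "dirichlet_kernel_sq n x * \<bar>f x - c * w x\<bar> \<le> dirichlet_kernel_sq n x * (\<epsilon> * w x)"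
                using r(3)[OF elim True] by (intro mult_left_mono) auto
              moreover have "0 \<le> B * h x" using B0 by (simp add: h_def)
              ultimately show ?thesis by (simp add: abs_mult mult_ac)
            next
              case False
              have "dirichlet_kernel_sq n x * \<bar>f x - c * w x\<bar> \<le> B * h x"
                using KB[of x n] False x unfolding h_def by (intro mult_right_mono) auto
              moreover have "0 \<le> \<epsilon> * (dirichlet_kernel_sq n x * w x)" using that by (simp add: w_def)
              ultimately show ?thesis by (simp add: abs_mult)
            qed
          qed
        qed
      qed
      also have "\<dots> = \<epsilon> * J n + B * (LINT x:{-pi..pi}|lebesgue. h x)"
        using set_integral_add(2)[OF set_integrable_mult_right[OF _, OF Kwi[of n], of \<epsilon>] set_integrable_mult_right[OF _, OF hi, of B]]
        by (simp add: J)
      finally show ?thesis .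
    qed
    thus ?thesis by blast
  qed
  have Jasymp: "J \<sim>[at_top] (\<lambda>n. 4 * ln (real n))" unfolding J_def by (rule odd_harmonic_sum_asymp)
  have "LIM n sequentially. 4 * ln (real n) :> at_top"
    by (intro filterlim_tendsto_pos_mult_at_top[OF tendsto_const] filterlim_compose[OF ln_at_top] filterlim_real_sequentially) auto
  hence Jtop: "LIM n sequentially. J n :> at_top"
    using asymp_equiv_at_top_transfer[OF asymp_equiv_symI[OF Jasymp]] by blast
  have J0: "J n \<ge> 0" for n unfolding J_def by (intro sum_nonneg) auto
  have "(\<lambda>n. I n - c * J n) \<in> o(\<lambda>n. c * J n)"
  proof (rule landau_o.smallI)
    fix e :: real assume e: "e > 0"
    obtain C where C: "\<And>n. \<bar>I n - c * J n\<bar> \<le> (e * c / 2) * J n + C" using bound[of "e * c / 2"] e c by auto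
    have "\<forall>\<^sub>F n in sequentially. J n \<ge> C / (e * c / 2)" using Jtop by (simp add: filterlim_at_top)
    thus "\<forall>\<^sub>F n in sequentially. norm (I n - c * J n) \<le> e * norm (c * J n)"
    proof eventually_elim
      case (elim n)
      hence "C \<le> (e * c / 2) * J n" using e c by (simp add: field_simps)
      thus ?case using C[of n] J0[of n] c by (simp add: abs_mult)
    qed
  qed
  hence "I \<sim>[at_top] (\<lambda>n. c * J n)" by (rule smallo_imp_asymp_equiv)
  also have "(\<lambda>n. c * J n) \<sim>[at_top] (\<lambda>n. c * (4 * ln (real n)))"
    by (intro asymp_equiv_intros Jasymp)
  finally show ?thesis by (simp add: I_def mult_ac)
qed

lemma integrable_mult_of_square:
  fixes X Z :: "'a \<Rightarrow> real"
  assumes [measurable]: "X \<in> borel_measurable M" "Z \<in> borel_measurable M"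
    and "integrable M (\<lambda>\<omega>. (X \<omega>)\<^sup>2)" "integrable M (\<lambda>\<omega>. (Z \<omega>)\<^sup>2)"
  shows "integrable M (\<lambda>\<omega>. X \<omega> * Z \<omega>)"
proof (rule Bochner_Integration.integrable_bound)
  show "integrable M (\<lambda>\<omega>. (X \<omega>)\<^sup>2 + (Z \<omega>)\<^sup>2)" using assms by simp
  have "\<bar>x * z\<bar> \<le> x\<^sup>2 + z\<^sup>2" for x z :: real
  proof -
    have "2 * (\<bar>x\<bar> * \<bar>z\<bar>) \<le> x\<^sup>2 + z\<^sup>2"
      using sum_squares_bound[of "\<bar>x\<bar>" "\<bar>z\<bar>"] by (simp only: power2_abs mult.assoc)
    moreover have "0 \<le> \<bar>x\<bar> * \<bar>z\<bar>" by simp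
    ultimately show ?thesis unfolding abs_mult by linarith
  qed
  thus "AE \<omega> in M. norm (X \<omega> * Z \<omega>) \<le> norm ((X \<omega>)\<^sup>2 + (Z \<omega>)\<^sup>2)" by simp
qed measurable

lemma (in prob_space) integrable_of_square:
  fixes X :: "'a \<Rightarrow> real"
  assumes "X \<in> borel_measurable M" "integrable M (\<lambda>\<omega>. (X \<omega>)\<^sup>2)"
  shows "integrable M X"
  using integrable_mult_of_square[of X M "\<lambda>_. 1"] assms by simp

lemma integral_double_sum:
  fixes f :: "'i \<Rightarrow> 'j \<Rightarrow> 'a \<Rightarrow> 'b::{banach, second_countable_topology}"
  assumes "\<And>i j. i \<in> I \<Longrightarrow> j \<in> J \<Longrightarrow> integrable M (f i j)"
  shows "(\<integral>x. (\<Sum>i\<in>I. \<Sum>j\<in>J. f i j x) \<partial>M) = (\<Sum>i\<in>I. \<Sum>j\<in>J. \<integral>x. f i j x \<partial>M)"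
  using assms by (simp add: Bochner_Integration.integral_sum)

lemma (in prob_space) variance_sum_covariance:
  fixes Y :: "'i \<Rightarrow> 'a \<Rightarrow> real"
  assumes m[measurable]: "\<And>i. i \<in> I \<Longrightarrow> Y i \<in> borel_measurable M"
    and sq: "\<And>i. i \<in> I \<Longrightarrow> integrable M (\<lambda>\<omega>. (Y i \<omega>)\<^sup>2)"
  shows "variance (\<lambda>\<omega>. \<Sum>i\<in>I. Y i \<omega>) = (\<Sum>i\<in>I. \<Sum>j\<in>I. covariance (Y i) (Y j))"
proof -
  have int: "integrable M (Y i)" if "i \<in> I" for i using integrable_of_square m sq that by blast
  define Z where "Z i \<omega> = Y i \<omega> - expectation (Y i)" for i \<omega>
  have [measurable]: "Z i \<in> borel_measurable M" if "i \<in> I" for i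
    using m[OF that] unfolding Z_def by measurable
  have "integrable M (\<lambda>\<omega>. (Z i \<omega>)\<^sup>2)" if "i \<in> I" for i
    unfolding Z_def power2_diff using int[OF that] sq[OF that] by (intro Bochner_Integration.integrable_add Bochner_Integration.integrable_diff) auto
  hence zz: "integrable M (\<lambda>\<omega>. Z i \<omega> * Z j \<omega>)" if "i \<in> I" "j \<in> I" for i j
    using that by (intro integrable_mult_of_square) auto
  have "expectation (\<lambda>\<omega>. \<Sum>i\<in>I. Y i \<omega>) = (\<Sum>i\<in>I. expectation (Y i))"
    using int by (intro Bochner_Integration.integral_sum) auto
  hence "variance (\<lambda>\<omega>. \<Sum>i\<in>I. Y i \<omega>) = expectation (\<lambda>\<omega>. \<Sum>i\<in>I. \<Sum>j\<in>I. Z i \<omega> * Z j \<omega>)"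
    by (simp add: Z_def sum_subtractf power2_eq_square sum_product[symmetric])
  also have "\<dots> = (\<Sum>i\<in>I. \<Sum>j\<in>I. expectation (\<lambda>\<omega>. Z i \<omega> * Z j \<omega>))"
    using zz by (intro integral_double_sum)
  finally show ?thesis by (simp add: covariance_def Z_def)
qed

lemma dirichlet_kernel_sq_double_sum:
  "complex_of_real (dirichlet_kernel_sq n x) = (\<Sum>s=1..n. \<Sum>t=1..n. exp (\<i> * of_int (int t - int s) * of_real x))"
proof -
  have "complex_of_real (dirichlet_kernel_sq n x) = cnj (\<Sum>s=1..n. cis (real s * x)) * (\<Sum>t=1..n. cis (real t * x))"
    unfolding dirichlet_kernel_sq_def complex_norm_square by (simp add: mult.commute)
  also have "\<dots> = (\<Sum>s=1..n. \<Sum>t=1..n. cis (- (real s * x)) * cis (real t * x))"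
    by (simp only: cnj_sum cis_cnj sum_product)
  finally show ?thesis
    by (simp add: cis_mult) (simp add: cis_conv_exp algebra_simps)
qed

text \<open>
  Each covariance is a Fourier coefficient of \<open>f\<close>, and the double sum of the characters \<open>e\<^bsup>i(t-s)x\<^esup>\<close> is the kernel.
\<close>
lemma (in prob_space) variance_sum_spectral:
  fixes Y :: "int \<Rightarrow> 'a \<Rightarrow> real"
  assumes cs: "covariance_stationary Y" and sd: "spectral_density Y f"
  shows "variance (\<lambda>\<omega>. \<Sum>t=1..n. Y (int t) \<omega>) = (LINT x:{-pi..pi}|lebesgue. dirichlet_kernel_sq n x * f x)"
proof -
  let ?e = "\<lambda>h x. exp (\<i> * of_int h * of_real x) :: complex"
  have f: "f absolutely_integrable_on {-pi..pi}" using sd by (simp add: spectral_density_def)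
  have ei: "(\<lambda>x. ?e h x * of_real (f x)) absolutely_integrable_on {-pi..pi}" for h
    by (intro absolutely_integrable_continuous_mult absolutely_integrable_of_real f continuous_intros)
  have cov: "complex_of_real (covariance (Y (int s)) (Y (int t))) =
      (LINT x:{-pi..pi}|lebesgue. ?e (int t - int s) x * of_real (f x))" for s t
  proof -
    have "covariance (Y (int s)) (Y (int s + (int t - int s))) = covariance (Y 0) (Y (int t - int s))"
      using cs unfolding covariance_stationary_def by blast
    moreover have "int s + (int t - int s) = int t" by simp
    ultimately show ?thesis using sd unfolding spectral_density_def by metis
  qed
  have "variance (\<lambda>\<omega>. \<Sum>t=1..n. Y (int t) \<omega>) = (\<Sum>s=1..n. \<Sum>t=1..n. covariance (Y (int s)) (Y (int t)))"
    using cs by (intro variance_sum_covariance) (auto simp: covariance_stationary_def)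
  also have "complex_of_real \<dots> = (\<Sum>s=1..n. \<Sum>t=1..n. LINT x:{-pi..pi}|lebesgue. ?e (int t - int s) x * of_real (f x))"
    by (simp only: of_real_sum cov)
  also have "\<dots> = (LINT x:{-pi..pi}|lebesgue. (\<Sum>s=1..n. \<Sum>t=1..n. ?e (int t - int s) x * of_real (f x)))"
    using ei unfolding set_lebesgue_integral_def set_integrable_def scaleR_sum_right
    by (intro integral_double_sum[symmetric])
  also have "\<dots> = (LINT x:{-pi..pi}|lebesgue. complex_of_real (dirichlet_kernel_sq n x * f x))"
    unfolding of_real_mult dirichlet_kernel_sq_double_sum sum_distrib_right ..
  also have "\<dots> = complex_of_real (LINT x:{-pi..pi}|lebesgue. dirichlet_kernel_sq n x * f x)"
    by (rule set_integral_complex_of_real)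
  finally show ?thesis by (simp only: of_real_eq_iff)
qed

lemma (in prob_space) variance_sum_asymp:
  fixes Y :: "int \<Rightarrow> 'a \<Rightarrow> real"
  assumes "covariance_stationary Y" "spectral_density Y f" "c > 0" "f \<sim>[at 0] (\<lambda>x. c * \<bar>x\<bar>)"
  shows "(\<lambda>n. variance (\<lambda>\<omega>. \<Sum>t=1..n. Y (int t) \<omega>)) \<sim>[at_top] (\<lambda>n. 4 * c * ln (real n))"
  unfolding variance_sum_spectral[OF assms(1,2)]
  using assms by (intro dirichlet_kernel_integral_asymp) (auto simp: spectral_density_def)

section \<open>Uniqueness of Fourier coefficients\<close>

text \<open>
  Integrability is part of the predicate, so that it is stable under multiplication by trigonometric polynomials.
\<close>
definition fourier_null :: "(real \<Rightarrow> complex) \<Rightarrow> bool" where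
  "fourier_null v \<longleftrightarrow> v absolutely_integrable_on {-pi..pi} \<and>
     (\<forall>h::int. (LINT x:{-pi..pi}|lebesgue. cis (of_int h * x) * v x) = 0)"

lemma cis_mult_absolutely_integrable:
  assumes "v absolutely_integrable_on {-pi..pi}"
  shows "(\<lambda>x. cis (k * x) * v x) absolutely_integrable_on {-pi..pi}"
  unfolding cis_conv_exp by (intro absolutely_integrable_continuous_mult assms continuous_intros)

lemma fourier_null_add:
  assumes "fourier_null u" "fourier_null v"
  shows "fourier_null (\<lambda>x. u x + v x)"
proof -
  have u: "u absolutely_integrable_on {-pi..pi}" and v: "v absolutely_integrable_on {-pi..pi}"
    using assms by (auto simp: fourier_null_def)
  show ?thesis
    using assms set_integral_add(1)[OF u v]
      set_integral_add(2)[OF cis_mult_absolutely_integrable[OF u] cis_mult_absolutely_integrable[OF v]]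
    unfolding fourier_null_def distrib_left by simp
qed

lemma fourier_null_cmult:
  assumes "fourier_null v"
  shows "fourier_null (\<lambda>x. c * v x)"
proof -
  have v: "v absolutely_integrable_on {-pi..pi}"
    using assms by (auto simp: fourier_null_def)
  have "cis (of_int h * x) * (c * v x) = c * (cis (of_int h * x) * v x)" for h x
    by (rule mult.left_commute)
  thus ?thesis using assms v unfolding fourier_null_def
    by (simp only: set_integral_mult_right) (simp add: set_integrable_mult_right)
qed

lemma fourier_null_shift:
  assumes "fourier_null v"
  shows "fourier_null (\<lambda>x. cis (of_int k * x) * v x)"
proof -
  have e: "cis (of_int h * x) * (cis (of_int k * x) * v x) = cis (of_int (h + k) * x) * v x" for h x
    by (simp add: cis_mult mult.assoc[symmetric] distrib_right)
  thus ?thesis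
    using assms cis_mult_absolutely_integrable[of v "of_int k"] unfolding fourier_null_def
    by (simp only: e) blast
qed

text \<open>
  On the circle a linear function is a combination of \<open>e\<^sup>i\<^sup>x\<close> and \<open>e\<^sup>-\<^sup>i\<^sup>x\<close>, and multiplication by these only shifts the
  coefficients. Quantifying over all \<open>v\<close> makes the case of a product of polynomials immediate.
\<close>
lemma fourier_null_polynomial_mult:
  assumes "real_polynomial_function p" "fourier_null v"
  shows "fourier_null (\<lambda>x. of_real (p (cis x)) * v x)"
  using assms
proof (induction arbitrary: v rule: real_polynomial_function.induct)
  case (linear f)
  interpret bounded_linear f by fact
  define \<alpha> \<beta> where "\<alpha> = (of_real (f 1) - \<i> * of_real (f \<i>)) / 2"
    and "\<beta> = (of_real (f 1) + \<i> * of_real (f \<i>)) / 2"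
  have "complex_of_real (f (cis x)) * v x =
      \<alpha> * (cis (of_int 1 * x) * v x) + \<beta> * (cis (of_int (- 1) * x) * v x)" for x
  proof -
    have "cis x = cos x *\<^sub>R 1 + sin x *\<^sub>R \<i>" by (simp add: complex_eq_iff)
    hence "f (cis x) = cos x * f 1 + sin x * f \<i>" by (simp add: add scaleR)
    hence "complex_of_real (f (cis x)) = \<alpha> * cis x + \<beta> * cis (- x)"
      by (simp add: \<alpha>_def \<beta>_def complex_eq_iff field_simps)
    thus ?thesis by (simp add: distrib_right mult.assoc)
  qed
  thus ?case by (simp only:) (intro fourier_null_add fourier_null_cmult fourier_null_shift linear.prems)
next
  case (const c)
  thus ?case by (intro fourier_null_cmult)
next
  case (add f g)
  thus ?case using fourier_null_add by (simp add: distrib_right)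
next
  case (mult f g)
  show ?case using mult.IH(1)[OF mult.IH(2)[OF mult.prems]] by (simp add: mult.assoc)
qed

text \<open>
  Stone-Weierstrass on the unit circle: \<open>g\<close> is a uniform limit of polynomials, for which the integral vanishes.
\<close>
lemma fourier_null_integral_continuous:
  fixes g :: "complex \<Rightarrow> real"
  assumes g: "continuous_on UNIV g" and u: "u absolutely_integrable_on {-pi..pi}"
    and null: "fourier_null (\<lambda>x. of_real (u x))"
  shows "(LINT x:{-pi..pi}|lebesgue. g (cis x) * u x) = 0"
proof -
  have gc: "continuous_on S (\<lambda>x. g (cis x))" for S
    unfolding cis_conv_exp by (intro continuous_on_compose2[OF g] continuous_intros) auto
  have gu: "(\<lambda>x. g (cis x) * u x) absolutely_integrable_on {-pi..pi}"
    by (intro absolutely_integrable_continuous_mult gc u)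
  have uabs: "(\<lambda>x. \<bar>u x\<bar>) absolutely_integrable_on {-pi..pi}"
    using set_integrable_norm[OF u] by simp
  define U where "U = (LINT x:{-pi..pi}|lebesgue. \<bar>u x\<bar>)"
  have U0: "U \<ge> 0" unfolding U_def set_lebesgue_integral_def by (intro Bochner_Integration.integral_nonneg) auto
  have "\<bar>LINT x:{-pi..pi}|lebesgue. g (cis x) * u x\<bar> \<le> e * U" if "e > 0" for e
  proof -
    note Stone_Weierstrass_real_polynomial_function[OF compact_sphere[of "0::complex" 1] continuous_on_subset[OF g subset_UNIV] that]
    then obtain p where p: "real_polynomial_function p" "\<And>z. z \<in> sphere 0 1 \<Longrightarrow> \<bar>g z - p z\<bar> < e"
      by blast
    have "continuous_on UNIV p"
      using p(1) continuous_on_polymonial_function real_polynomial_function_eq by blast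
    hence pc: "continuous_on S (\<lambda>x. p (cis x))" for S
      unfolding cis_conv_exp by (elim continuous_on_compose2) (intro continuous_intros | simp)+
    have pu: "(\<lambda>x. p (cis x) * u x) absolutely_integrable_on {-pi..pi}"
      by (intro absolutely_integrable_continuous_mult pc u)
    have "fourier_null (\<lambda>x. of_real (p (cis x)) * of_real (u x))"
      by (rule fourier_null_polynomial_mult[OF p(1) null])
    hence "(LINT x:{-pi..pi}|lebesgue. cis (of_int 0 * x) * (complex_of_real (p (cis x)) * of_real (u x))) = 0"
      unfolding fourier_null_def by blast
    hence "complex_of_real (LINT x:{-pi..pi}|lebesgue. p (cis x) * u x) = 0"
      unfolding set_integral_complex_of_real[symmetric] by simp
    hence "(LINT x:{-pi..pi}|lebesgue. g (cis x) * u x) = (LINT x:{-pi..pi}|lebesgue. (g (cis x) - p (cis x)) * u x)"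
      using set_integral_diff(2)[OF gu pu] by (simp add: left_diff_distrib)
    moreover have gpu: "(\<lambda>x. (g (cis x) - p (cis x)) * u x) absolutely_integrable_on {-pi..pi}"
      using set_integral_diff(1)[OF gu pu] by (simp add: left_diff_distrib)
    ultimately have "\<bar>LINT x:{-pi..pi}|lebesgue. g (cis x) * u x\<bar>
        \<le> (LINT x:{-pi..pi}|lebesgue. \<bar>(g (cis x) - p (cis x)) * u x\<bar>)"
      using set_integral_norm_bound[OF gpu] by simp
    also have "\<dots> \<le> (LINT x:{-pi..pi}|lebesgue. e * \<bar>u x\<bar>)"
    proof (rule set_integral_mono)
      show "(\<lambda>x. \<bar>(g (cis x) - p (cis x)) * u x\<bar>) absolutely_integrable_on {-pi..pi}"
        using set_integrable_norm[OF gpu] by simp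
      show "(\<lambda>x. e * \<bar>u x\<bar>) absolutely_integrable_on {-pi..pi}"
        by (intro set_integrable_mult_right uabs)
      show "\<bar>(g (cis x) - p (cis x)) * u x\<bar> \<le> e * \<bar>u x\<bar>" for x
        unfolding abs_mult using p(2)[of "cis x"] by (intro mult_right_mono) auto
    qed
    finally show ?thesis by (simp add: U_def)
  qed
  note le = this
  have "\<bar>LINT x:{-pi..pi}|lebesgue. g (cis x) * u x\<bar> \<le> 0 + e" if "e > 0" for e
  proof -
    \<comment> \<open>\<open>U\<close> may vanish, hence the denominator \<open>U + 1\<close>.\<close>
    have "e / (U + 1) > 0" using that U0 by simp
    moreover have "e / (U + 1) * U \<le> e" using that U0 by (simp add: field_simps)
    ultimately show ?thesis using le[of "e / (U + 1)"] by linarith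
  qed
  hence "\<bar>LINT x:{-pi..pi}|lebesgue. g (cis x) * u x\<bar> \<le> 0" by (rule field_le_epsilon)
  thus ?thesis by simp
qed

text \<open>
  The indicator of \<open>K\<close> is the pointwise limit of the tent functions \<open>max 0 (1 - m dist(z, cis ` K))\<close> on the circle.
  The endpoints \<open>\<plusminus>\<pi>\<close> are excluded because the circle does not separate them.
\<close>
lemma fourier_null_integral_compact:
  assumes K: "compact K" "K \<subseteq> {-pi<..<pi}" and u: "u absolutely_integrable_on {-pi..pi}"
    and null: "fourier_null (\<lambda>x. of_real (u x))"
  shows "(LINT x:K|lebesgue. u x) = 0"
proof (cases "K = {}")
  case False
  define C where "C = cis ` K"
  have C: "closed C" "C \<noteq> {}" unfolding C_def cis_conv_exp using K(1) False
    by (auto intro!: compact_imp_closed compact_continuous_image continuous_intros)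
  have mem: "cis x \<in> C \<longleftrightarrow> x \<in> K" if "x \<in> {-pi..pi}" for x
  proof
    assume "cis x \<in> C"
    then obtain y where y: "y \<in> K" "cis x = cis y" by (auto simp: C_def)
    hence "sin x = sin y \<and> cos x = cos y" by (simp add: complex_eq_iff)
    then obtain n :: int where n: "x = y + 2 * pi * of_int n"
      unfolding sin_cos_eq_iff by blast
    have "y \<in> {-pi<..<pi}" using y K by blast
    hence "\<bar>y\<bar> < pi" "\<bar>x\<bar> \<le> pi" using that by auto
    hence "\<bar>2 * pi * of_int n\<bar> < 2 * pi" using n by linarith
    hence "n = 0" by (simp add: abs_mult)
    thus "x \<in> K" using n y by simp
  next
    assume "x \<in> K"
    thus "cis x \<in> C" unfolding C_def by (rule imageI)
  qed
  define g where "g = (\<lambda>(m::nat) z. max 0 (1 - real m * infdist z C))"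
  have g: "continuous_on UNIV (g m)" for m
    unfolding g_def by (intro continuous_intros)
  have gc: "continuous_on S (\<lambda>x. g m (cis x))" for S m
    unfolding cis_conv_exp by (intro continuous_on_compose2[OF g] continuous_intros) auto
  have "(\<lambda>m. LINT x:{-pi..pi}|lebesgue. g m (cis x) * u x) \<longlonglongrightarrow> (LINT x:{-pi..pi}|lebesgue. indicator K x * u x)"
    unfolding set_lebesgue_integral_def
  proof (rule integral_dominated_convergence[where w = "\<lambda>x. norm (indicator {-pi..pi} x *\<^sub>R u x)"])
    have "K \<in> sets lebesgue" using K(1) by (intro fmeasurableD lmeasurable_compact)
    moreover have "(\<lambda>x. indicator {-pi..pi} x *\<^sub>R u x) \<in> borel_measurable lebesgue"
      using u unfolding set_integrable_def by blast
    ultimately have "(\<lambda>x. indicator K x *\<^sub>R (indicator {-pi..pi} x *\<^sub>R u x)) \<in> borel_measurable lebesgue"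
      by (rule borel_measurable_scaleR[OF borel_measurable_indicator])
    thus "(\<lambda>x. indicator {-pi..pi} x *\<^sub>R (indicator K x * u x)) \<in> borel_measurable lebesgue"
      by (simp add: mult_ac)
    show "(\<lambda>x. indicator {-pi..pi} x *\<^sub>R (g m (cis x) * u x)) \<in> borel_measurable lebesgue" for m
      using absolutely_integrable_continuous_mult[OF gc u] unfolding set_integrable_def by blast
    show "integrable lebesgue (\<lambda>x. norm (indicator {-pi..pi} x *\<^sub>R u x))"
      using u unfolding set_integrable_def by (rule integrable_norm)
    show "AE x in lebesgue. norm (indicator {-pi..pi} x *\<^sub>R (g m (cis x) * u x)) \<le> norm (indicator {-pi..pi} x *\<^sub>R u x)" for m
    proof (rule AE_I2)
      fix x
      have "\<bar>g m (cis x)\<bar> \<le> 1" by (simp add: g_def infdist_nonneg)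
      thus "norm (indicator {-pi..pi} x *\<^sub>R (g m (cis x) * u x)) \<le> norm (indicator {-pi..pi} x *\<^sub>R u x)"
        by (simp add: indicator_def abs_mult mult_left_le_one_le)
    qed
    show "AE x in lebesgue. (\<lambda>m. indicator {-pi..pi} x *\<^sub>R (g m (cis x) * u x)) \<longlonglongrightarrow> indicator {-pi..pi} x *\<^sub>R (indicator K x * u x)"
    proof (rule AE_I2)
      fix x
      have "(\<lambda>m. g m (cis x)) \<longlonglongrightarrow> indicator K x" if x: "x \<in> {-pi..pi}"
      proof (cases "x \<in> K")
        case True
        hence "infdist (cis x) C = 0" using mem[OF x] C by (simp add: in_closed_iff_infdist_zero)
        thus ?thesis using True by (simp add: g_def)
      next
        case False
        hence d: "infdist (cis x) C > 0" using mem[OF x] C infdist_pos_not_in_closed by blast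
        then obtain N where N: "1 < real N * infdist (cis x) C"
          using reals_Archimedean3 by blast
        have "g m (cis x) = 0" if "m \<ge> N" for m
        proof -
          have "real N * infdist (cis x) C \<le> real m * infdist (cis x) C"
            using that d by (intro mult_right_mono) auto
          thus ?thesis using N by (simp add: g_def)
        qed
        hence "\<forall>\<^sub>F m in sequentially. g m (cis x) = 0"
          unfolding eventually_sequentially by blast
        thus ?thesis using False by (simp add: tendsto_eventually)
      qed
      thus "(\<lambda>m. indicator {-pi..pi} x *\<^sub>R (g m (cis x) * u x)) \<longlonglongrightarrow> indicator {-pi..pi} x *\<^sub>R (indicator K x * u x)"
        by (cases "x \<in> {-pi..pi}") (auto intro!: tendsto_intros)
    qed
  qed
  moreover have "(LINT x:{-pi..pi}|lebesgue. g m (cis x) * u x) = 0" for m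
    by (rule fourier_null_integral_continuous[OF g u null])
  ultimately have "(LINT x:{-pi..pi}|lebesgue. indicator K x * u x) = 0"
    by (simp add: LIMSEQ_const_iff)
  moreover have "indicator {-pi..pi} x *\<^sub>R (indicator K x * u x) = indicator K x *\<^sub>R u x" for x
    using K(2) by (auto simp: indicator_def)
  ultimately show ?thesis unfolding set_lebesgue_integral_def by (simp only:)
qed (simp add: set_lebesgue_integral_def)

text \<open>
  A Lebesgue set is, up to a null set, an increasing union of compact sets; so the integral of \<open>u\<close> over every
  measurable subset of the open interval vanishes.
\<close>
lemma fourier_null_AE_zero:
  assumes u: "u absolutely_integrable_on {-pi..pi}" and null: "fourier_null (\<lambda>x. of_real (u x))"
  shows "AE x in lebesgue. x \<in> {-pi..pi} \<longrightarrow> u x = 0"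
proof -
  define v where "v x = indicator {-pi<..<pi} x *\<^sub>R u x" for x
  have ui: "u absolutely_integrable_on A" if "A \<in> sets lebesgue" "A \<subseteq> {-pi..pi}" for A
    using set_integrable_subset[OF u that] .
  have "integrable lebesgue v"
    using ui[of "{-pi<..<pi}"] unfolding v_def set_integrable_def by fastforce
  moreover have "(LINT x:A|lebesgue. v x) = (LINT x:A|lebesgue. 0)" if A: "A \<in> sets lebesgue" for A
  proof -
    let ?A = "A \<inter> {-pi<..<pi}"
    have A': "?A \<in> sets lebesgue" using A by auto
    obtain C N where CN: "fsigma C" "N \<in> null_sets lebesgue" "C \<union> N = ?A" "disjnt C N"
      using lebesgue_set_almost_fsigma[OF A'] by metis
    obtain F :: "nat \<Rightarrow> real set" where F: "range F \<subseteq> Collect compact" "C = \<Union>(range F)"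
      using CN(1) fsigma_Union_compact[of C] by auto
    define G where "G n = (\<Union>i\<le>n. F i)" for n
    have G1: "compact (G n)" for n
      using F(1) unfolding G_def by (intro compact_UN) auto
    have G2: "G n \<subseteq> {-pi<..<pi}" for n
      using F(2) CN(3) unfolding G_def by auto
    have Cpi: "C \<subseteq> {-pi..pi}"
    proof
      fix x assume "x \<in> C"
      hence "x \<in> ?A" using CN(3) by blast
      thus "x \<in> {-pi..pi}" by simp
    qed
    have UG: "(\<Union>n. G n) = C" unfolding G_def F(2) by auto
    have Csets: "C \<in> sets lebesgue" unfolding UG[symmetric] using G1
      by (intro sets.countable_UN) (auto intro: fmeasurableD lmeasurable_compact)
    have "(\<lambda>n. LINT x:G n|lebesgue. u x) \<longlonglongrightarrow> (LINT x:(\<Union>n. G n)|lebesgue. u x)"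
    proof (rule set_integral_cont_up)
      show "G n \<in> sets lebesgue" for n using G1 by (auto intro: fmeasurableD lmeasurable_compact)
      show "incseq G" unfolding G_def incseq_def by (auto intro: order_trans)
      show "u absolutely_integrable_on (\<Union>n. G n)" unfolding UG by (intro ui Csets Cpi)
    qed
    moreover have "(LINT x:G n|lebesgue. u x) = 0" for n
      by (rule fourier_null_integral_compact[OF G1 G2 u null])
    ultimately have "(LINT x:C|lebesgue. u x) = 0" unfolding UG by (simp add: LIMSEQ_const_iff)
    moreover have "(LINT x:?A|lebesgue. u x) = (LINT x:C|lebesgue. u x)"
    proof (rule set_integral_cong_set)
      show "set_borel_measurable lebesgue ?A u" "set_borel_measurable lebesgue C u"
        using ui[OF A'] greaterThanLessThan_subseteq_atLeastAtMost_iff[of "-pi" pi "-pi" pi] ui[OF Csets Cpi] unfolding set_integrable_def set_borel_measurable_def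
        by (auto dest!: borel_measurable_integrable)
      show "AE x in lebesgue. (x \<in> C) = (x \<in> ?A)"
        using AE_not_in[OF CN(2)] unfolding CN(3)[symmetric] by eventually_elim blast
    qed
    moreover have "(LINT x:A|lebesgue. v x) = (LINT x:?A|lebesgue. u x)"
      unfolding set_lebesgue_integral_def v_def by (intro Bochner_Integration.integral_cong) (auto simp: indicator_def)
    ultimately show ?thesis by (simp add: set_lebesgue_integral_def)
  qed
  ultimately have "AE x in lebesgue. v x = 0"
    by (intro density_unique_real) auto
  moreover have "AE x in lebesgue. x \<notin> {pi, -pi}"
    by (rule AE_not_in) (simp add: negligible_iff_null_sets[symmetric])
  ultimately show ?thesis by eventually_elim (auto simp: v_def indicator_def split: if_splits)
qed

lemma (in prob_space) spectral_density_unique: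
  assumes f: "spectral_density Y f" and g: "spectral_density Y g"
  shows "AE x in lebesgue. x \<in> {-pi..pi} \<longrightarrow> g x = f x"
proof -
  have fi: "f absolutely_integrable_on {-pi..pi}" and gi: "g absolutely_integrable_on {-pi..pi}"
    using f g by (auto simp: spectral_density_def)
  note u = set_integral_diff(1)[OF gi fi]
  have "fourier_null (\<lambda>x. of_real (g x - f x))"
    unfolding fourier_null_def
  proof (intro conjI allI absolutely_integrable_of_real u)
    fix h :: int
    have e: "cis (of_int h * x) = exp (\<i> * of_int h * of_real x)" for x
      by (simp add: cis_conv_exp mult_ac)
    have "(LINT x:{-pi..pi}|lebesgue. cis (of_int h * x) * of_real (g x)) =
        (LINT x:{-pi..pi}|lebesgue. cis (of_int h * x) * of_real (f x))"
      using f g unfolding spectral_density_def e by metis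
    thus "(LINT x:{-pi..pi}|lebesgue. cis (of_int h * x) * complex_of_real (g x - f x)) = 0"
      using set_integral_diff(2)[OF cis_mult_absolutely_integrable cis_mult_absolutely_integrable,
          OF absolutely_integrable_of_real[OF gi] absolutely_integrable_of_real[OF fi], of "of_int h" "of_int h"]
      by (simp add: right_diff_distrib)
  qed
  from fourier_null_AE_zero[OF u this] show ?thesis by simp
qed

section \<open>The binomial series of the square root\<close>

text \<open>
  The coefficients of the binomial series of \<open>(1 - z)\<^bsup>1/2\<^esup>\<close>.
\<close>
definition sqrt_coeff :: "nat \<Rightarrow> real" where
  "sqrt_coeff j = (- 1) ^ j * ((1 / 2) gchoose j)"

lemma sqrt_coeff_Suc: "sqrt_coeff (Suc j) = sqrt_coeff j * (real j - 1 / 2) / (real j + 1)"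
proof -
  have "real (Suc j) * ((1 / 2 :: real) gchoose Suc j) = (1 / 2 - real j) * ((1 / 2) gchoose j)"
    using gbinomial_mult_1[of "1 / 2 :: real" j] by (simp add: algebra_simps)
  hence g: "((1 / 2 :: real) gchoose Suc j) = (1 / 2 - real j) * ((1 / 2) gchoose j) / (real j + 1)"
    by (simp add: field_simps)
  show ?thesis unfolding sqrt_coeff_def g by (simp add: field_simps)
qed

lemma sqrt_coeff_neg: "j \<ge> 1 \<Longrightarrow> sqrt_coeff j < 0"
proof (induction j rule: nat_induct_at_least)
  case base
  show ?case by (simp add: sqrt_coeff_def)
next
  case (Suc j)
  thus ?case by (simp add: sqrt_coeff_Suc divide_neg_pos mult_neg_pos)
qed

lemma Gamma_minus_half: "Gamma (- 1 / 2 :: real) = - 2 * sqrt pi"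
proof -
  have "(- 1 / 2 :: real) \<notin> \<int>"
    using fraction_not_in_Ints[where 'a = real, of 2 "- 1"] by simp
  hence "(- 1 / 2 :: real) \<notin> \<int>\<^sub>\<le>\<^sub>0" using nonpos_Ints_subset_Ints by blast
  from Gamma_plus1[OF this] show ?thesis
    using Gamma_one_half_real by simp
qed

text \<open>
  The squared form of the Gamma function asymptotics of binomial coefficients, with \<open>\<Gamma>(-1/2)\<^sup>2 = 4\<pi>\<close>. Squaring removes
  the sign and the fractional power.
\<close>
lemma sqrt_coeff_sq_limit: "(\<lambda>j. (sqrt_coeff j)\<^sup>2 * real j ^ 3) \<longlonglongrightarrow> 1 / (4 * pi)"
proof -
  have "(\<lambda>n. (((1 / 2 :: real) gchoose n) / ((- 1) ^ n / exp ((1 / 2 + 1) * ln (real n))))\<^sup>2)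
      \<longlonglongrightarrow> (inverse (Gamma (- (1 / 2))))\<^sup>2"
    using gbinomial_asymptotic[of "1 / 2 :: real"] by (intro tendsto_power) simp
  also have "(inverse (Gamma (- (1 / 2))))\<^sup>2 = 1 / (4 * pi)"
    using Gamma_minus_half by (simp add: power_inverse power_mult_distrib inverse_eq_divide power_divide)
  finally show ?thesis
  proof (rule Lim_transform_eventually)
    show "\<forall>\<^sub>F n in sequentially. (((1 / 2 :: real) gchoose n) / ((- 1) ^ n / exp ((1 / 2 + 1) * ln (real n))))\<^sup>2
        = (sqrt_coeff n)\<^sup>2 * real n ^ 3"
      using eventually_gt_at_top[of 0]
    proof eventually_elim
      case (elim n)
      have "(exp ((1 / 2 + 1) * ln (real n)))\<^sup>2 = exp (3 * ln (real n))"
        by (simp add: power2_eq_square exp_add[symmetric])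
      also have "\<dots> = real n ^ 3"
        using elim exp_of_nat_mult[of 3 "ln (real n)"] by simp
      finally have "(exp ((1 / 2 + 1) * ln (real n)))\<^sup>2 = real n ^ 3" .
      thus ?case unfolding sqrt_coeff_def
        by (simp only: power_mult_distrib power_divide divide_divide_eq_right power_even_eq[symmetric])
          (simp add: power_mult[symmetric] mult.commute)
    qed
  qed
qed

text \<open>
  The sequence on the right decreases to its limit \<open>1 / (4\<pi>)\<close>; this reduces to \<open>(j - 1/2)\<^sup>2 (j + 1) \<le> j\<^sup>3\<close>.
\<close>
lemma sqrt_coeff_sq_lower:
  assumes "j \<ge> 1"
  shows "1 / (4 * pi) \<le> (sqrt_coeff j)\<^sup>2 * real j ^ 3"
proof -
  have step: "(sqrt_coeff (Suc j))\<^sup>2 * real (Suc j) ^ 3 \<le> (sqrt_coeff j)\<^sup>2 * real j ^ 3" if "j \<ge> 1" for j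
  proof -
    have aux: "(s * x / d)\<^sup>2 * d ^ 3 = s\<^sup>2 * (x\<^sup>2 * d)" if "d \<noteq> 0" for s x d :: real
      using that by (simp add: power2_eq_square power3_eq_cube)
    have "(sqrt_coeff (Suc j))\<^sup>2 * real (Suc j) ^ 3 = (sqrt_coeff j)\<^sup>2 * ((real j - 1 / 2)\<^sup>2 * (real j + 1))"
      using aux[of "real j + 1"] by (simp add: sqrt_coeff_Suc add.commute)
    moreover have "(real j - 1 / 2)\<^sup>2 * (real j + 1) \<le> real j ^ 3"
      using that by (simp add: power2_eq_square power3_eq_cube algebra_simps)
    ultimately show ?thesis by (simp add: mult_left_mono)
  qed
  have "decseq (\<lambda>i. (sqrt_coeff (i + j))\<^sup>2 * real (i + j) ^ 3)"
  proof (rule decseq_SucI)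
    fix i
    show "(sqrt_coeff (Suc i + j))\<^sup>2 * real (Suc i + j) ^ 3 \<le> (sqrt_coeff (i + j))\<^sup>2 * real (i + j) ^ 3"
      using step[of "i + j"] assms by simp
  qed
  moreover have "(\<lambda>i. (sqrt_coeff (i + j))\<^sup>2 * real (i + j) ^ 3) \<longlonglongrightarrow> 1 / (4 * pi)"
    using sqrt_coeff_sq_limit by (rule LIMSEQ_ignore_initial_segment)
  ultimately show ?thesis using decseq_ge[of _ _ 0] by fastforce
qed

text \<open>
  With \<open>j - 1/2\<close> in place of \<open>j\<close> the sequence increases to the same limit. Together with the lower bound this traps the
  limit within a relative error \<open>O(1/j)\<close>.
\<close>
lemma sqrt_coeff_sq_upper:
  assumes "j \<ge> 1"
  shows "(sqrt_coeff j)\<^sup>2 * (real j - 1 / 2) ^ 3 \<le> 1 / (4 * pi)"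
proof -
  have step: "(sqrt_coeff j)\<^sup>2 * (real j - 1 / 2) ^ 3 \<le> (sqrt_coeff (Suc j))\<^sup>2 * (real (Suc j) - 1 / 2) ^ 3" if "j \<ge> 1" for j
  proof -
    have *: "(real j - 1 / 2) * (real j + 1)\<^sup>2 \<le> (real j + 1 / 2) ^ 3"
      by (simp add: power2_eq_square power3_eq_cube algebra_simps)
    have "(sqrt_coeff j)\<^sup>2 * (real j - 1 / 2) ^ 3
        = (sqrt_coeff j)\<^sup>2 * (real j - 1 / 2)\<^sup>2 / (real j + 1)\<^sup>2 * ((real j - 1 / 2) * (real j + 1)\<^sup>2)"
      by (simp add: power2_eq_square power3_eq_cube)
    also have "\<dots> \<le> (sqrt_coeff j)\<^sup>2 * (real j - 1 / 2)\<^sup>2 / (real j + 1)\<^sup>2 * (real j + 1 / 2) ^ 3"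
      using * by (intro mult_left_mono) auto
    also have "\<dots> = (sqrt_coeff (Suc j))\<^sup>2 * (real (Suc j) - 1 / 2) ^ 3"
    proof -
      have "real (Suc j) - 1 / 2 = real j + 1 / 2" by simp
      thus ?thesis unfolding sqrt_coeff_Suc by (simp only: power_mult_distrib power_divide)
    qed
    finally show ?thesis .
  qed
  have "incseq (\<lambda>i. (sqrt_coeff (i + j))\<^sup>2 * (real (i + j) - 1 / 2) ^ 3)"
  proof (rule incseq_SucI)
    fix i
    show "(sqrt_coeff (i + j))\<^sup>2 * (real (i + j) - 1 / 2) ^ 3 \<le> (sqrt_coeff (Suc i + j))\<^sup>2 * (real (Suc i + j) - 1 / 2) ^ 3"
      using step[of "i + j"] assms by simp
  qed
  moreover have "(\<lambda>i. (sqrt_coeff (i + j))\<^sup>2 * (real (i + j) - 1 / 2) ^ 3) \<longlonglongrightarrow> 1 / (4 * pi)"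
  proof (rule LIMSEQ_ignore_initial_segment[where f = "\<lambda>i. (sqrt_coeff i)\<^sup>2 * (real i - 1 / 2) ^ 3"])
    have "(\<lambda>i. (sqrt_coeff i)\<^sup>2 * real i ^ 3 * (1 - 1 / 2 * (1 / real i)) ^ 3) \<longlonglongrightarrow> 1 / (4 * pi) * (1 - 1 / 2 * 0) ^ 3"
      by (intro tendsto_intros sqrt_coeff_sq_limit lim_1_over_n)
    hence "(\<lambda>i. (sqrt_coeff i)\<^sup>2 * real i ^ 3 * (1 - 1 / 2 * (1 / real i)) ^ 3) \<longlonglongrightarrow> 1 / (4 * pi)" by simp
    thus "(\<lambda>i. (sqrt_coeff i)\<^sup>2 * (real i - 1 / 2) ^ 3) \<longlonglongrightarrow> 1 / (4 * pi)"
    proof (rule Lim_transform_eventually)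
      show "\<forall>\<^sub>F i in sequentially. (sqrt_coeff i)\<^sup>2 * real i ^ 3 * (1 - 1 / 2 * (1 / real i)) ^ 3
          = (sqrt_coeff i)\<^sup>2 * (real i - 1 / 2) ^ 3"
        using eventually_gt_at_top[of 0]
      proof eventually_elim
        case (elim i)
        have "real i * (1 - 1 / 2 * (1 / real i)) = real i - 1 / 2" using elim by (simp add: right_diff_distrib)
        thus ?case by (simp only: mult.assoc power_mult_distrib[symmetric])
      qed
    qed
  qed
  ultimately show ?thesis using incseq_le[of _ _ 0] by fastforce
qed

text \<open>
  With \<open>p = - b\<^sub>j j\<^bsup>3/2\<^esup>\<close>, \<open>L = 1 / (2 \<surd>\<pi>)\<close> and \<open>y = 1 / (2j)\<close>, the two monotone bounds say
  \<open>L\<^sup>2 \<le> p\<^sup>2\<close> and \<open>p\<^sup>2 (1 - y)\<^sup>3 \<le> L\<^sup>2\<close>. The second one gives \<open>p\<^sup>2 \<le> 8 L\<^sup>2\<close> as \<open>y \<le> 1/2\<close>. With Bernoulli,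
  \<open>p\<^sup>2 - L\<^sup>2 \<le> 3 y p\<^sup>2 \<le> 24 y L\<^sup>2\<close>, and dividing by \<open>p + L \<ge> 2L\<close> yields \<open>p - L \<le> 12 L y\<close>.
\<close>
lemma sqrt_coeff_asymp:
  assumes j: "j \<ge> 1"
  shows "\<bar>sqrt_coeff j + 1 / (2 * sqrt pi) * real j powr (-3/2)\<bar> \<le> 3 / sqrt pi * real j powr (-5/2)"
proof -
  define L p where "L = 1 / (2 * sqrt pi)" and "p = - sqrt_coeff j * real j powr (3/2)"
  have L: "L > 0" "L\<^sup>2 = 1 / (4 * pi)" by (simp_all add: L_def power_divide power_mult_distrib)
  have p0: "p > 0" using sqrt_coeff_neg[OF j] j by (simp add: p_def mult_neg_pos)
  have "(real j powr (3/2))\<^sup>2 = real j ^ 3"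
    using j by (simp add: power2_eq_square powr_add[symmetric] powr_numeral)
  hence p2: "p\<^sup>2 = (sqrt_coeff j)\<^sup>2 * real j ^ 3" by (simp add: p_def power_mult_distrib)
  define y where "y = 1 / (2 * real j)"
  have y: "0 < y" "y \<le> 1 / 2" using j by (simp_all add: y_def field_simps)
  have "real j * (1 - y) = real j - 1 / 2" using j by (simp add: y_def right_diff_distrib)
  hence up: "p\<^sup>2 * (1 - y) ^ 3 \<le> L\<^sup>2"
    using sqrt_coeff_sq_upper[OF j] unfolding p2 L(2) mult.assoc power_mult_distrib[symmetric] by simp
  have "L\<^sup>2 \<le> p\<^sup>2" using sqrt_coeff_sq_lower[OF j] unfolding p2 L(2) .
  hence Lp: "L \<le> p" using p0 by (rule_tac power2_le_imp_le) auto
  have "(1 / 2) ^ 3 \<le> (1 - y) ^ 3" using y by (intro power_mono) auto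
  hence "p\<^sup>2 * (1 / 2) ^ 3 \<le> p\<^sup>2 * (1 - y) ^ 3" by (intro mult_left_mono) auto
  hence p8: "p\<^sup>2 \<le> 8 * L\<^sup>2" using up by (simp add: power3_eq_cube)
  have "1 - 3 * y \<le> (1 - y) ^ 3"
  proof -
    have "(1 - y) ^ 3 - (1 - 3 * y) = y\<^sup>2 * (3 - y)" by (simp add: power2_eq_square power3_eq_cube algebra_simps)
    moreover have "y\<^sup>2 * (3 - y) \<ge> 0" using y by simp
    ultimately show ?thesis by linarith
  qed
  hence "p\<^sup>2 * (1 - 3 * y) \<le> p\<^sup>2 * (1 - y) ^ 3" by (intro mult_left_mono) auto
  hence "p\<^sup>2 - L\<^sup>2 \<le> p\<^sup>2 * (3 * y)" using up by (simp add: right_diff_distrib)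
  also have "\<dots> \<le> 8 * L\<^sup>2 * (3 * y)" using p8 y by (intro mult_right_mono) auto
  finally have "(p - L) * (p + L) \<le> 24 * L\<^sup>2 * y" by (simp add: power2_eq_square algebra_simps)
  moreover have "(p - L) * (2 * L) \<le> (p - L) * (p + L)" using Lp by (intro mult_left_mono) auto
  ultimately have "(2 * L) * (p - L) \<le> (2 * L) * (12 * L * y)" by (simp add: power2_eq_square algebra_simps)
  hence pL: "p - L \<le> 12 * L * y" using L by (simp only: mult_le_cancel_left_pos)
  have "sqrt_coeff j = - p * real j powr (-3/2)"
    using j by (simp add: p_def powr_add[symmetric] mult.assoc)
  hence "sqrt_coeff j + L * real j powr (-3/2) = - ((p - L) * real j powr (-3/2))"
    by (simp add: algebra_simps)
  hence "\<bar>sqrt_coeff j + L * real j powr (-3/2)\<bar> = (p - L) * real j powr (-3/2)"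
    using Lp by (simp add: abs_mult)
  also have "\<dots> \<le> 12 * L * y * real j powr (-3/2)" using pL by (intro mult_right_mono) auto
  also have "\<dots> = 6 * L * (real j powr (-3/2) / real j)" by (simp add: y_def)
  also have "real j powr (-3/2) / real j = real j powr (-3/2 - 1)" using j by (simp only: powr_diff) simp
  finally show ?thesis by (simp add: L_def)
qed

lemma summable_sqrt_coeff: "summable (\<lambda>j. \<bar>sqrt_coeff j\<bar>)"
proof (rule summable_comparison_test_ev)
  show "summable (\<lambda>j. 1 / (2 * sqrt pi) * real j powr (-3/2) + 3 / sqrt pi * real j powr (-5/2))"
    by (intro summable_add summable_mult) (simp_all add: summable_real_powr_iff)
  show "\<forall>\<^sub>F j in sequentially. norm \<bar>sqrt_coeff j\<bar> \<le> 1 / (2 * sqrt pi) * real j powr (-3/2) + 3 / sqrt pi * real j powr (-5/2)"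
    using eventually_ge_at_top[of 1]
  proof eventually_elim
    case (elim j)
    have "0 \<le> 1 / (2 * sqrt pi) * real j powr (-3/2)" by simp
    thus ?case using sqrt_coeff_asymp[OF elim] unfolding real_norm_def by linarith
  qed
qed

text \<open>
  Cauchy product and Vandermonde: the coefficients of the square are \<open>(-1)\<^sup>k\<close> times \<open>1 choose k\<close>. Absolute summability
  makes this valid up to and including the unit circle.
\<close>
lemma sqrt_coeff_series_square:
  fixes z :: complex
  assumes z: "cmod z \<le> 1"
  shows "(\<Sum>j. of_real (sqrt_coeff j) * z ^ j)\<^sup>2 = 1 - z"
proof -
  let ?b = "\<lambda>j. of_real (sqrt_coeff j) * z ^ j"
  have s: "summable (\<lambda>j. norm (?b j))"
  proof (rule summable_comparison_test[OF _ summable_sqrt_coeff])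
    show "\<exists>N. \<forall>n\<ge>N. norm (norm (?b n)) \<le> \<bar>sqrt_coeff n\<bar>"
      using z by (intro exI[of _ 0]) (auto simp: norm_mult norm_power intro!: mult_left_le power_le_one)
  qed
  have conv: "(\<Sum>i\<le>k. ?b i * ?b (k - i)) = (if k = 0 then 1 else if k = 1 then - z else 0)" for k
  proof -
    have "(\<Sum>i\<le>k. sqrt_coeff i * sqrt_coeff (k - i)) =
        (-1) ^ k * (\<Sum>i=0..k. ((1/2) gchoose i) * ((1/2) gchoose (k - i)))"
      unfolding sum_distrib_left atLeast0AtMost
    proof (rule sum.cong)
      fix i assume "i \<in> {..k}"
      hence "(- 1 :: real) ^ k = (- 1) ^ i * (- 1) ^ (k - i)" by (simp flip: power_add)
      thus "sqrt_coeff i * sqrt_coeff (k - i) = (-1) ^ k * ((1/2 gchoose i) * (1/2 gchoose (k - i)))"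
        by (simp add: sqrt_coeff_def)
    qed simp
    also have "\<dots> = (-1) ^ k * (1 gchoose k)" unfolding gbinomial_Vandermonde by simp
    also have "(1 :: real) gchoose k = of_nat (1 choose k)" by (simp add: binomial_gbinomial)
    finally have sc: "(\<Sum>i\<le>k. sqrt_coeff i * sqrt_coeff (k - i)) = (-1) ^ k * of_nat (1 choose k)" .
    have "(\<Sum>i\<le>k. ?b i * ?b (k - i)) = (\<Sum>i\<le>k. of_real (sqrt_coeff i * sqrt_coeff (k - i)) * z ^ k)"
    proof (rule sum.cong)
      fix i assume "i \<in> {..k}"
      hence "z ^ k = z ^ i * z ^ (k - i)" by (simp flip: power_add)
      thus "?b i * ?b (k - i) = of_real (sqrt_coeff i * sqrt_coeff (k - i)) * z ^ k" by (simp add: mult_ac)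
    qed simp
    also have "\<dots> = of_real ((-1) ^ k * of_nat (1 choose k)) * z ^ k"
      by (simp only: sum_distrib_right[symmetric] of_real_sum[symmetric] sc)
    also have "\<dots> = (if k = 0 then 1 else if k = 1 then - z else 0)"
      by (cases "k \<le> 1") (auto simp: le_Suc_eq binomial_eq_0)
    finally show ?thesis .
  qed
  have "(\<lambda>k. if k = 0 then 1 else if k = 1 then - z else 0) sums (\<Sum>k\<in>{0, 1::nat}. if k = 0 then 1 else if k = 1 then - z else 0)"
    by (rule sums_finite) auto
  hence "(\<lambda>k. if k = (0::nat) then 1 else if k = 1 then - z else 0) sums (1 - z)" by simp
  moreover have "(\<lambda>k. \<Sum>i\<le>k. ?b i * ?b (k - i)) sums ((\<Sum>j. ?b j) * (\<Sum>j. ?b j))"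
    by (rule Cauchy_product_sums[OF s s])
  ultimately show ?thesis unfolding conv power2_eq_square using sums_unique2 by blast
qed

section \<open>The transfer function near frequency zero\<close>

definition transfer_function :: "(nat \<Rightarrow> real) \<Rightarrow> real \<Rightarrow> complex" where
  "transfer_function a x = (\<Sum>j. of_real (a j) * cis (real j * x))"

lemma summable_transfer_function:
  assumes "summable (\<lambda>j. \<bar>a j\<bar>)"
  shows "summable (\<lambda>j. norm (complex_of_real (a j) * cis (real j * x)))"
  using assms by (simp add: norm_mult)

text \<open>
  The leading terms \<open>c j\<^bsup>-3/2\<^esup>\<close> cancel, and both error terms are \<open>O(j\<^bsup>-5/2\<^esup>)\<close>,
  which leaves room for the weight \<open>j\<close>.
\<close>
lemma memory_minus_half_diff:
  assumes "memory_minus_half c a"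
  defines "e \<equiv> \<lambda>j. a j + 2 * sqrt pi * c * sqrt_coeff j"
  shows "summable (\<lambda>j. real j * \<bar>e j\<bar>)" and "summable (\<lambda>j. \<bar>e j\<bar>)"
proof -
  obtain r where r: "r \<in> O(\<lambda>j. 1 / real j)" "\<And>j. j \<ge> 1 \<Longrightarrow> a j = c * real j powr (-3/2) * (1 + r j)"
    using assms(1) by (auto simp: memory_minus_half_def)
  from r(1) obtain K where K: "K > 0" "\<forall>\<^sub>F j in sequentially. norm (r j) \<le> K * norm (1 / real j)"
    by (elim landau_o.bigE)
  have ev: "\<forall>\<^sub>F j in sequentially. \<bar>e j\<bar> \<le> \<bar>c\<bar> * (K + 6) * real j powr (-5/2)"
    using K(2) eventually_ge_at_top[of 1]
  proof eventually_elim
    case (elim j)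
    have ej: "e j = c * real j powr (-3/2) * r j + 2 * sqrt pi * c * (sqrt_coeff j + 1 / (2 * sqrt pi) * real j powr (-3/2))"
      by (simp add: e_def r(2)[OF elim(2)] algebra_simps)
    have "\<bar>e j\<bar> \<le> \<bar>c * real j powr (-3/2) * r j\<bar> + \<bar>2 * sqrt pi * c * (sqrt_coeff j + 1 / (2 * sqrt pi) * real j powr (-3/2))\<bar>"
      unfolding ej by (rule abs_triangle_ineq)
    also have "\<dots> = \<bar>c\<bar> * real j powr (-3/2) * \<bar>r j\<bar> + 2 * sqrt pi * \<bar>c\<bar> * \<bar>sqrt_coeff j + 1 / (2 * sqrt pi) * real j powr (-3/2)\<bar>"
      by (simp only: abs_mult) simp
    also have "\<dots> \<le> \<bar>c\<bar> * real j powr (-3/2) * (K / real j) + 2 * sqrt pi * \<bar>c\<bar> * (3 / sqrt pi * real j powr (-5/2))"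
      using elim sqrt_coeff_asymp[OF elim(2)] by (intro add_mono mult_left_mono) auto
    also have "real j powr (-5/2) = real j powr (-3/2 - 1)" by simp
    also have "real j powr (-3/2 - 1) = real j powr (-3/2) / real j" using elim(2) by (simp only: powr_diff) simp
    also have "\<bar>c\<bar> * real j powr (-3/2) * (K / real j) + 2 * sqrt pi * \<bar>c\<bar> * (3 / sqrt pi * (real j powr (-3/2) / real j))
        = \<bar>c\<bar> * (K + 6) * (real j powr (-3/2) / real j)"
      by (simp add: field_simps) (simp add: add_divide_distrib)
    also have "real j powr (-3/2) / real j = real j powr (-3/2 - 1)" using elim(2) by (simp only: powr_diff) simp
    finally show ?case by simp
  qed
  show "summable (\<lambda>j. \<bar>e j\<bar>)"
  proof (rule summable_comparison_test_ev)
    show "summable (\<lambda>j. \<bar>c\<bar> * (K + 6) * real j powr (-5/2))"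
      by (intro summable_mult) (simp add: summable_real_powr_iff)
    show "\<forall>\<^sub>F j in sequentially. norm \<bar>e j\<bar> \<le> \<bar>c\<bar> * (K + 6) * real j powr (-5/2)" using ev by simp
  qed
  show "summable (\<lambda>j. real j * \<bar>e j\<bar>)"
  proof (rule summable_comparison_test_ev)
    show "summable (\<lambda>j. \<bar>c\<bar> * (K + 6) * real j powr (-3/2))"
      by (intro summable_mult) (simp add: summable_real_powr_iff)
    show "\<forall>\<^sub>F j in sequentially. norm (real j * \<bar>e j\<bar>) \<le> \<bar>c\<bar> * (K + 6) * real j powr (-3/2)"
      using ev eventually_ge_at_top[of 1]
    proof eventually_elim
      case (elim j)
      have "real j * \<bar>e j\<bar> \<le> real j * (\<bar>c\<bar> * (K + 6) * real j powr (-5/2))"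
        using elim(1) by (intro mult_left_mono) auto
      also have "\<dots> = \<bar>c\<bar> * (K + 6) * (real j powr 1 * real j powr (-5/2))" using elim(2) by simp
      also have "real j powr 1 * real j powr (-5/2) = real j powr (-3/2)"
        by (simp only: powr_add[symmetric]) simp
      finally show ?case by simp
    qed
  qed
qed

lemma memory_minus_half_summable:
  assumes "memory_minus_half c a"
  shows "summable (\<lambda>j. \<bar>a j\<bar>)"
proof (rule summable_comparison_test)
  show "summable (\<lambda>j. \<bar>a j + 2 * sqrt pi * c * sqrt_coeff j\<bar> + \<bar>2 * sqrt pi * c\<bar> * \<bar>sqrt_coeff j\<bar>)"
    by (intro summable_add summable_mult summable_sqrt_coeff memory_minus_half_diff[OF assms])
  have "\<bar>a n\<bar> \<le> \<bar>a n + 2 * sqrt pi * c * sqrt_coeff n\<bar> + \<bar>2 * sqrt pi * c\<bar> * \<bar>sqrt_coeff n\<bar>" for n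
    unfolding abs_mult[symmetric] by linarith
  thus "\<exists>N. \<forall>n\<ge>N. norm \<bar>a n\<bar> \<le> \<bar>a n + 2 * sqrt pi * c * sqrt_coeff n\<bar> + \<bar>2 * sqrt pi * c\<bar> * \<bar>sqrt_coeff n\<bar>"
    by simp
qed

text \<open>
  Since the coefficients sum to \<open>0\<close>, each character \<open>e\<^sup>i\<^sup>j\<^sup>x\<close> may be replaced by \<open>e\<^sup>i\<^sup>j\<^sup>x - 1\<close>, which is at most \<open>j \<bar>x\<bar>\<close> in
  modulus.
\<close>
lemma transfer_function_lipschitz_at_0:
  assumes e: "summable (\<lambda>j. real j * \<bar>e j\<bar>)" "summable (\<lambda>j. \<bar>e j\<bar>)" and e0: "(\<Sum>j. e j) = 0"
  shows "cmod (transfer_function e x) \<le> (\<Sum>j. real j * \<bar>e j\<bar>) * \<bar>x\<bar>"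
proof -
  have s: "summable (\<lambda>j. complex_of_real (e j) * cis (real j * x))"
    by (rule summable_norm_cancel) (rule summable_transfer_function[OF e(2)])
  have es: "e sums 0" using summable_rabs_cancel[OF e(2)] e0 by (simp add: sums_iff)
  hence "(\<lambda>j. complex_of_real (e j)) sums 0" using sums_of_real[OF es, where 'a = complex] by simp
  from sums_diff[OF summable_sums[OF s] this]
  have tf: "transfer_function e x = (\<Sum>j. of_real (e j) * (cis (real j * x) - 1))"
    unfolding transfer_function_def by (simp add: sums_iff right_diff_distrib)
  have bnd: "norm (complex_of_real (e j) * (cis (real j * x) - 1)) \<le> real j * \<bar>e j\<bar> * \<bar>x\<bar>" for j
  proof -
    have "cmod (cis (real j * x) - 1) = 2 * \<bar>sin (real j * x / 2)\<bar>"
      by (subst norm_minus_commute) (rule cmod_one_minus_cis_abs)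
    also have "\<dots> \<le> 2 * \<bar>real j * x / 2\<bar>" by (intro mult_left_mono abs_sin_x_le_abs_x) auto
    also have "\<dots> = real j * \<bar>x\<bar>" by (simp add: abs_mult)
    finally have "\<bar>e j\<bar> * cmod (cis (real j * x) - 1) \<le> \<bar>e j\<bar> * (real j * \<bar>x\<bar>)" by (intro mult_left_mono) auto
    thus ?thesis by (simp add: norm_mult mult_ac)
  qed
  have "cmod (\<Sum>j. of_real (e j) * (cis (real j * x) - 1)) \<le> (\<Sum>j. real j * \<bar>e j\<bar> * \<bar>x\<bar>)"
    using bnd by (intro norm_suminf_le summable_mult2 e)
  also have "\<dots> = (\<Sum>j. real j * \<bar>e j\<bar>) * \<bar>x\<bar>" by (rule suminf_mult2[symmetric, OF e(1)])
  finally show ?thesis unfolding tf .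
qed

lemma transfer_function_sqrt_coeff: "(cmod (transfer_function sqrt_coeff x))\<^sup>2 = 2 * \<bar>sin (x / 2)\<bar>"
proof -
  have "(transfer_function sqrt_coeff x)\<^sup>2 = 1 - cis x"
  proof -
    have "transfer_function sqrt_coeff x = (\<Sum>j. of_real (sqrt_coeff j) * cis x ^ j)"
      by (simp only: transfer_function_def Complex.DeMoivre)
    thus ?thesis using sqrt_coeff_series_square[of "cis x"] by (simp only: norm_cis order.refl)
  qed
  thus ?thesis by (metis norm_power cmod_one_minus_cis_abs)
qed

text \<open>
  Decompose \<open>a = e - 2 \<surd>\<pi> c b\<close> with \<open>b\<close> the binomial coefficients. After division by \<open>\<bar>x\<bar>\<^bsup>1/2\<^esup>\<close> the first part
  tends to \<open>0\<close> and the second has modulus tending to \<open>2 \<surd>\<pi> \<bar>c\<bar>\<close>.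
\<close>
lemma transfer_function_asymp:
  assumes "memory_minus_half c a"
  shows "((\<lambda>x. (cmod (transfer_function a x))\<^sup>2 / \<bar>x\<bar>) \<longlongrightarrow> 4 * pi * c\<^sup>2) (at 0)"
proof -
  define \<kappa> where "\<kappa> = 2 * sqrt pi * c"
  define e where "e j = a j + \<kappa> * sqrt_coeff j" for j
  note e = memory_minus_half_diff[OF assms, folded \<kappa>_def, folded e_def]
  have tf: "summable (\<lambda>j. complex_of_real (f j) * cis (real j * x))" if "summable (\<lambda>j. \<bar>f j\<bar>)" for f x
    by (rule summable_norm_cancel) (rule summable_transfer_function[OF that])
  have b0: "(\<Sum>j. sqrt_coeff j) = 0"
  proof -
    have "transfer_function sqrt_coeff 0 = of_real (\<Sum>j. sqrt_coeff j)"
      unfolding transfer_function_def using summable_rabs_cancel[OF summable_sqrt_coeff] by (simp add: suminf_of_real)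
    thus ?thesis using transfer_function_sqrt_coeff[of 0] by simp
  qed
  have "(\<Sum>j. e j) = (\<Sum>j. a j) + \<kappa> * (\<Sum>j. sqrt_coeff j)"
    unfolding e_def using assms summable_rabs_cancel[OF summable_sqrt_coeff]
    by (subst suminf_add[symmetric] suminf_mult[symmetric] | auto simp: memory_minus_half_def sums_iff intro: summable_mult)+
  hence e0: "(\<Sum>j. e j) = 0" using b0 assms by (simp add: memory_minus_half_def sums_iff)
  have dec: "transfer_function a x = transfer_function e x - \<kappa> * transfer_function sqrt_coeff x" for x
  proof -
    have "a j = e j - \<kappa> * sqrt_coeff j" for j by (simp add: e_def)
    hence "transfer_function a x = (\<Sum>j. of_real (e j) * cis (real j * x) - \<kappa> * (of_real (sqrt_coeff j) * cis (real j * x)))"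
      unfolding transfer_function_def by (simp add: left_diff_distrib mult.assoc)
    also have "\<dots> = transfer_function e x - \<kappa> * transfer_function sqrt_coeff x"
      unfolding transfer_function_def
      using suminf_diff[OF tf[OF e(2)] summable_mult[OF tf[OF summable_sqrt_coeff]]]
        suminf_mult[OF tf[OF summable_sqrt_coeff]] by simp
    finally show ?thesis .
  qed
  define C where "C = (\<Sum>j. real j * \<bar>e j\<bar>)"
  define B where "B = (\<lambda>x. cmod (\<kappa> * transfer_function sqrt_coeff x))"
  have "((\<lambda>x. sqrt (\<kappa>\<^sup>2 * (2 * \<bar>sin (x / 2)\<bar> / \<bar>x\<bar>))) \<longlongrightarrow> sqrt (\<kappa>\<^sup>2 * 1)) (at (0::real))"
    by (intro tendsto_intros two_abs_sin_half_asymp)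
  moreover have "sqrt (\<kappa>\<^sup>2 * (2 * \<bar>sin (x / 2)\<bar> / \<bar>x\<bar>)) = B x / sqrt \<bar>x\<bar>" for x
    unfolding transfer_function_sqrt_coeff[symmetric] B_def by (simp add: real_sqrt_mult real_sqrt_divide norm_mult)
  ultimately have lim: "((\<lambda>x. B x / sqrt \<bar>x\<bar>) \<longlongrightarrow> \<bar>\<kappa>\<bar>) (at 0)" by simp
  have "((\<lambda>x. cmod (transfer_function a x) / sqrt \<bar>x\<bar> - B x / sqrt \<bar>x\<bar>) \<longlongrightarrow> 0) (at 0)"
  proof (rule Lim_null_comparison)
    have "((\<lambda>x. C * sqrt \<bar>x\<bar>) \<longlongrightarrow> C * sqrt \<bar>0\<bar>) (at (0::real))" by (intro tendsto_intros)
    thus "((\<lambda>x. C * sqrt \<bar>x\<bar>) \<longlongrightarrow> 0) (at (0::real))" by simp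
    have "\<bar>cmod (transfer_function a x) / sqrt \<bar>x\<bar> - B x / sqrt \<bar>x\<bar>\<bar> \<le> C * sqrt \<bar>x\<bar>" if "x \<noteq> 0" for x
    proof -
      have "\<bar>cmod (transfer_function a x) - B x\<bar> \<le> cmod (transfer_function e x)"
        using norm_triangle_ineq3[of "transfer_function a x" "- (\<kappa> * transfer_function sqrt_coeff x)"]
        unfolding B_def dec[of x] by simp
      also have "\<dots> \<le> C * \<bar>x\<bar>" unfolding C_def by (rule transfer_function_lipschitz_at_0[OF e e0])
      finally have "\<bar>cmod (transfer_function a x) - B x\<bar> / sqrt \<bar>x\<bar> \<le> C * \<bar>x\<bar> / sqrt \<bar>x\<bar>"
        by (intro divide_right_mono) auto
      also have "C * \<bar>x\<bar> / sqrt \<bar>x\<bar> = C * sqrt \<bar>x\<bar>" by (simp only: times_divide_eq_right[symmetric] real_div_sqrt abs_ge_zero)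
      finally show ?thesis by (simp add: diff_divide_distrib[symmetric])
    qed
    thus "\<forall>\<^sub>F x in at 0. norm (cmod (transfer_function a x) / sqrt \<bar>x\<bar> - B x / sqrt \<bar>x\<bar>) \<le> C * sqrt \<bar>x\<bar>"
      by (simp add: eventually_at_filter)
  qed
  from tendsto_power[OF tendsto_add[OF this lim], of 2]
  have "((\<lambda>x. (cmod (transfer_function a x) / sqrt \<bar>x\<bar>)\<^sup>2) \<longlongrightarrow> \<kappa>\<^sup>2) (at 0)" by simp
  thus ?thesis by (simp add: power_divide \<kappa>_def power_mult_distrib)
qed

section \<open>Mean-square limits\<close>

text \<open>
  The quadratic form \<open>E (sU - tV)\<^sup>2\<close> is nonnegative. For \<open>E U\<^sup>2 > 0\<close> it is evaluated at \<open>s = E UV\<close> and \<open>t = E U\<^sup>2\<close>; for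
  \<open>E U\<^sup>2 = 0\<close> the choice \<open>s = E V\<^sup>2 + 1\<close>, \<open>t = E UV\<close> forces \<open>E UV = 0\<close>.
\<close>
lemma (in prob_space) expectation_cauchy_schwarz:
  fixes U V :: "'a \<Rightarrow> real"
  assumes [measurable]: "U \<in> borel_measurable M" "V \<in> borel_measurable M"
    and U: "integrable M (\<lambda>\<omega>. (U \<omega>)\<^sup>2)" and V: "integrable M (\<lambda>\<omega>. (V \<omega>)\<^sup>2)"
  shows "\<bar>expectation (\<lambda>\<omega>. U \<omega> * V \<omega>)\<bar> \<le> sqrt (expectation (\<lambda>\<omega>. (U \<omega>)\<^sup>2)) * sqrt (expectation (\<lambda>\<omega>. (V \<omega>)\<^sup>2))"
proof -
  define A B C where "A = expectation (\<lambda>\<omega>. (U \<omega>)\<^sup>2)" and "B = expectation (\<lambda>\<omega>. U \<omega> * V \<omega>)"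
    and "C = expectation (\<lambda>\<omega>. (V \<omega>)\<^sup>2)"
  have UV: "integrable M (\<lambda>\<omega>. U \<omega> * V \<omega>)" by (rule integrable_mult_of_square) (use U V in auto)
  have quad: "0 \<le> s\<^sup>2 * A - 2 * s * t * B + t\<^sup>2 * C" for s t
  proof -
    have "0 \<le> expectation (\<lambda>\<omega>. (s * U \<omega> - t * V \<omega>)\<^sup>2)" by (intro Bochner_Integration.integral_nonneg) simp
    also have "(\<lambda>\<omega>. (s * U \<omega> - t * V \<omega>)\<^sup>2) = (\<lambda>\<omega>. s\<^sup>2 * (U \<omega>)\<^sup>2 - (2 * s * t) * (U \<omega> * V \<omega>) + t\<^sup>2 * (V \<omega>)\<^sup>2)"
      by (simp add: power2_eq_square algebra_simps)
    also have "expectation \<dots> = s\<^sup>2 * A - 2 * s * t * B + t\<^sup>2 * C"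
      using U V UV by (simp add: A_def B_def C_def)
    finally show ?thesis .
  qed
  have A: "A \<ge> 0" unfolding A_def by (intro Bochner_Integration.integral_nonneg) simp
  have "B\<^sup>2 \<le> A * C"
  proof (cases "A = 0")
    case False
    have "0 \<le> A * (A * C - B\<^sup>2)" using quad[of B A] by (simp add: power2_eq_square algebra_simps)
    thus ?thesis using A False by (simp add: zero_le_mult_iff)
  next
    case True
    have "0 \<le> - (2 * ((C + 1) * B * B)) + B\<^sup>2 * C"
      using quad[of "C + 1" B] True by (simp add: mult_ac)
    hence "0 \<le> - (B\<^sup>2 * (C + 2))" by (simp add: power2_eq_square algebra_simps)
    moreover have "C \<ge> 0" unfolding C_def by (intro Bochner_Integration.integral_nonneg) simp
    ultimately have "B\<^sup>2 * (C + 2) \<le> 0 * (C + 2)" by simp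
    hence "B\<^sup>2 \<le> 0" using \<open>C \<ge> 0\<close> by (subst (asm) mult_le_cancel_right_pos) auto
    thus ?thesis using True by simp
  qed
  hence "\<bar>B\<bar> \<le> sqrt (A * C)" by (rule real_le_rsqrt[of "\<bar>B\<bar>", simplified])
  thus ?thesis by (simp add: A_def B_def C_def real_sqrt_mult)
qed

lemma integrable_square_diff:
  fixes U V :: "'a \<Rightarrow> real"
  assumes "U \<in> borel_measurable M" "V \<in> borel_measurable M"
    and "integrable M (\<lambda>\<omega>. (U \<omega>)\<^sup>2)" "integrable M (\<lambda>\<omega>. (V \<omega>)\<^sup>2)"
  shows "integrable M (\<lambda>\<omega>. (U \<omega> - V \<omega>)\<^sup>2)"
  unfolding power2_diff mult.assoc using assms integrable_mult_of_square[of U M V] by simp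

text \<open>
  Fatou: for fixed \<open>n\<close>, \<open>(Z - X\<^sub>n)\<^sup>2\<close> is almost surely the limit of \<open>(X\<^sub>m - X\<^sub>n)\<^sup>2\<close> as \<open>m\<close> tends to infinity.
\<close>
lemma (in prob_space) L2_limit_of_AE_limit:
  fixes X :: "nat \<Rightarrow> 'a \<Rightarrow> real"
  assumes m[measurable]: "\<And>n. X n \<in> borel_measurable M" "Z \<in> borel_measurable M"
    and sq: "\<And>n. integrable M (\<lambda>\<omega>. (X n \<omega>)\<^sup>2)"
    and cauchy: "\<And>m n. m \<ge> n \<Longrightarrow> expectation (\<lambda>\<omega>. (X m \<omega> - X n \<omega>)\<^sup>2) \<le> \<eta> n"
    and lim: "AE \<omega> in M. (\<lambda>n. X n \<omega>) \<longlonglongrightarrow> Z \<omega>"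
  shows "integrable M (\<lambda>\<omega>. (Z \<omega>)\<^sup>2)" and "expectation (\<lambda>\<omega>. (Z \<omega> - X n \<omega>)\<^sup>2) \<le> \<eta> n"
proof -
  have sqd: "integrable M (\<lambda>\<omega>. (X m \<omega> - X n \<omega>)\<^sup>2)" for m n
    by (intro integrable_square_diff m sq)
  have nn: "(\<integral>\<^sup>+\<omega>. ennreal ((Z \<omega> - X n \<omega>)\<^sup>2) \<partial>M) \<le> ennreal (\<eta> n)" for n
  proof -
    have "(\<integral>\<^sup>+\<omega>. ennreal ((Z \<omega> - X n \<omega>)\<^sup>2) \<partial>M) = (\<integral>\<^sup>+\<omega>. liminf (\<lambda>m. ennreal ((X m \<omega> - X n \<omega>)\<^sup>2)) \<partial>M)"
    proof (rule nn_integral_cong_AE)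
      show "AE \<omega> in M. ennreal ((Z \<omega> - X n \<omega>)\<^sup>2) = liminf (\<lambda>m. ennreal ((X m \<omega> - X n \<omega>)\<^sup>2))"
        using lim
      proof eventually_elim
        case (elim \<omega>)
        have "(\<lambda>m. ennreal ((X m \<omega> - X n \<omega>)\<^sup>2)) \<longlonglongrightarrow> ennreal ((Z \<omega> - X n \<omega>)\<^sup>2)"
          by (intro tendsto_ennrealI tendsto_intros elim)
        thus ?case by (rule lim_imp_Liminf[OF sequentially_bot, symmetric])
      qed
    qed
    also have "\<dots> \<le> liminf (\<lambda>m. \<integral>\<^sup>+\<omega>. ennreal ((X m \<omega> - X n \<omega>)\<^sup>2) \<partial>M)"
      by (rule nn_integral_liminf) measurable
    also have "\<dots> \<le> limsup (\<lambda>m. \<integral>\<^sup>+\<omega>. ennreal ((X m \<omega> - X n \<omega>)\<^sup>2) \<partial>M)"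
      by (rule Liminf_le_Limsup[OF sequentially_bot])
    also have "\<dots> \<le> ennreal (\<eta> n)"
    proof (rule Limsup_bounded)
      show "\<forall>\<^sub>F m in sequentially. (\<integral>\<^sup>+\<omega>. ennreal ((X m \<omega> - X n \<omega>)\<^sup>2) \<partial>M) \<le> ennreal (\<eta> n)"
        using eventually_ge_at_top[of n]
      proof eventually_elim
        case (elim m)
        show ?case using cauchy[OF elim] sqd[of m n]
          by (subst nn_integral_eq_integral) (auto intro: ennreal_leI)
      qed
    qed
    finally show ?thesis .
  qed
  have int: "integrable M (\<lambda>\<omega>. (Z \<omega> - X n \<omega>)\<^sup>2)" for n
  proof (rule integrableI_bounded)
    show "(\<integral>\<^sup>+\<omega>. ennreal (norm ((Z \<omega> - X n \<omega>)\<^sup>2)) \<partial>M) < \<infinity>"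
      using nn[of n] by (simp add: le_less_trans[OF _ ennreal_less_top])
  qed measurable
  have "0 \<le> expectation (\<lambda>\<omega>. (X n \<omega> - X n \<omega>)\<^sup>2)" by simp
  also have "\<dots> \<le> \<eta> n" by (rule cauchy) simp
  finally have "0 \<le> \<eta> n" .
  thus "expectation (\<lambda>\<omega>. (Z \<omega> - X n \<omega>)\<^sup>2) \<le> \<eta> n"
    using nn[of n] nn_integral_eq_integral[OF int[of n]] by simp
  have "integrable M (\<lambda>\<omega>. ((Z \<omega> - X 0 \<omega>) - (- X 0 \<omega>))\<^sup>2)"
    by (rule integrable_square_diff) (use int[of 0] sq[of 0] in auto)
  thus "integrable M (\<lambda>\<omega>. (Z \<omega>)\<^sup>2)" by simp
qed

text \<open>
  With \<open>dX = X\<^sup>\<prime> - X\<^sub>n\<close> and \<open>dZ = Z\<^sup>\<prime> - Z\<^sub>n\<close> one has \<open>X\<^sup>\<prime>Z\<^sup>\<prime> - X\<^sub>n Z\<^sub>n = X\<^sup>\<prime> dZ + dX Z\<^sup>\<prime> - dX dZ\<close>, and Cauchy-Schwarz bounds each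
  expectation.
\<close>
lemma (in prob_space) L2_product_limit:
  fixes X Z :: "nat \<Rightarrow> 'a \<Rightarrow> real"
  assumes m[measurable]: "\<And>n. X n \<in> borel_measurable M" "\<And>n. Z n \<in> borel_measurable M"
      "X' \<in> borel_measurable M" "Z' \<in> borel_measurable M"
    and sq: "\<And>n. integrable M (\<lambda>\<omega>. (X n \<omega>)\<^sup>2)" "\<And>n. integrable M (\<lambda>\<omega>. (Z n \<omega>)\<^sup>2)"
      "integrable M (\<lambda>\<omega>. (X' \<omega>)\<^sup>2)" "integrable M (\<lambda>\<omega>. (Z' \<omega>)\<^sup>2)"
    and lim: "(\<lambda>n. expectation (\<lambda>\<omega>. (X' \<omega> - X n \<omega>)\<^sup>2)) \<longlonglongrightarrow> 0"
      "(\<lambda>n. expectation (\<lambda>\<omega>. (Z' \<omega> - Z n \<omega>)\<^sup>2)) \<longlonglongrightarrow> 0"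
  shows "(\<lambda>n. expectation (\<lambda>\<omega>. X n \<omega> * Z n \<omega>)) \<longlonglongrightarrow> expectation (\<lambda>\<omega>. X' \<omega> * Z' \<omega>)"
proof -
  define dX dZ where "dX n \<omega> = X' \<omega> - X n \<omega>" and "dZ n \<omega> = Z' \<omega> - Z n \<omega>" for n \<omega>
  have [measurable]: "dX n \<in> borel_measurable M" "dZ n \<in> borel_measurable M" for n
    unfolding dX_def dZ_def by measurable
  have dsq: "integrable M (\<lambda>\<omega>. (dX n \<omega>)\<^sup>2)" "integrable M (\<lambda>\<omega>. (dZ n \<omega>)\<^sup>2)" for n
    unfolding dX_def dZ_def by (intro integrable_square_diff m sq)+
  let ?n = "\<lambda>U. sqrt (expectation (\<lambda>\<omega>. (U \<omega>)\<^sup>2))"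
  have dlim: "(\<lambda>n. ?n (dX n)) \<longlonglongrightarrow> 0" "(\<lambda>n. ?n (dZ n)) \<longlonglongrightarrow> 0"
    using tendsto_real_sqrt[OF lim(1)] tendsto_real_sqrt[OF lim(2)] by (simp_all add: dX_def dZ_def)
  have "(\<lambda>n. expectation (\<lambda>\<omega>. X' \<omega> * Z' \<omega>) - expectation (\<lambda>\<omega>. X n \<omega> * Z n \<omega>)) \<longlonglongrightarrow> 0"
  proof (rule Lim_null_comparison)
    have "(\<lambda>n. ?n X' * ?n (dZ n) + ?n (dX n) * ?n Z' + ?n (dX n) * ?n (dZ n)) \<longlonglongrightarrow> ?n X' * 0 + 0 * ?n Z' + 0 * 0"
      by (intro tendsto_intros dlim)
    thus "(\<lambda>n. ?n X' * ?n (dZ n) + ?n (dX n) * ?n Z' + ?n (dX n) * ?n (dZ n)) \<longlonglongrightarrow> 0" by simp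
    have "\<bar>expectation (\<lambda>\<omega>. X' \<omega> * Z' \<omega>) - expectation (\<lambda>\<omega>. X n \<omega> * Z n \<omega>)\<bar>
        \<le> ?n X' * ?n (dZ n) + ?n (dX n) * ?n Z' + ?n (dX n) * ?n (dZ n)" for n
    proof -
      have i: "integrable M (\<lambda>\<omega>. X' \<omega> * Z' \<omega>)" "integrable M (\<lambda>\<omega>. X n \<omega> * Z n \<omega>)"
        "integrable M (\<lambda>\<omega>. X' \<omega> * dZ n \<omega>)" "integrable M (\<lambda>\<omega>. dX n \<omega> * Z' \<omega>)" "integrable M (\<lambda>\<omega>. dX n \<omega> * dZ n \<omega>)"
        by (intro integrable_mult_of_square sq dsq; measurable)+
      have "expectation (\<lambda>\<omega>. X' \<omega> * Z' \<omega>) - expectation (\<lambda>\<omega>. X n \<omega> * Z n \<omega>)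
         = expectation (\<lambda>\<omega>. X' \<omega> * dZ n \<omega> + dX n \<omega> * Z' \<omega> - dX n \<omega> * dZ n \<omega>)"
        unfolding Bochner_Integration.integral_diff[OF i(1,2), symmetric]
        by (intro Bochner_Integration.integral_cong) (auto simp: dX_def dZ_def algebra_simps)
      also have "\<dots> = expectation (\<lambda>\<omega>. X' \<omega> * dZ n \<omega>) + expectation (\<lambda>\<omega>. dX n \<omega> * Z' \<omega>) - expectation (\<lambda>\<omega>. dX n \<omega> * dZ n \<omega>)"
        using i by simp
      finally show ?thesis
        using expectation_cauchy_schwarz[of X' "dZ n"] expectation_cauchy_schwarz[of "dX n" Z']
          expectation_cauchy_schwarz[of "dX n" "dZ n"] sq dsq by auto
    qed
    thus "\<forall>\<^sub>F n in sequentially. norm (expectation (\<lambda>\<omega>. X' \<omega> * Z' \<omega>) - expectation (\<lambda>\<omega>. X n \<omega> * Z n \<omega>))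
        \<le> ?n X' * ?n (dZ n) + ?n (dX n) * ?n Z' + ?n (dX n) * ?n (dZ n)" by simp
  qed
  from tendsto_diff[OF tendsto_const this, of "expectation (\<lambda>\<omega>. X' \<omega> * Z' \<omega>)"] show ?thesis by simp
qed

section \<open>Covariances and spectral density of a linear process\<close>

text \<open>
  The second-order content of a centred i.i.d. sequence, which is all that covariances and spectral densities depend on.
\<close>
definition (in prob_space) white_noise :: "real \<Rightarrow> (int \<Rightarrow> 'a \<Rightarrow> real) \<Rightarrow> bool" where
  "white_noise v \<epsilon> \<longleftrightarrow> (\<forall>t. random_variable borel (\<epsilon> t) \<and> integrable M (\<lambda>\<omega>. (\<epsilon> t \<omega>)\<^sup>2) \<and> expectation (\<epsilon> t) = 0) \<and>
     (\<forall>s t. expectation (\<lambda>\<omega>. \<epsilon> s \<omega> * \<epsilon> t \<omega>) = (if s = t then v else 0))"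

lemma (in prob_space) iid_white_noise:
  assumes iid: "iid \<epsilon>" and sq: "integrable M (\<lambda>\<omega>. (\<epsilon> 0 \<omega>)\<^sup>2)" and mean: "expectation (\<epsilon> 0) = 0"
  shows "white_noise (variance (\<epsilon> 0)) \<epsilon>"
proof -
  have ind: "indep_vars (\<lambda>_. borel) \<epsilon> UNIV" and d: "\<And>t. distr M borel (\<epsilon> t) = distr M borel (\<epsilon> 0)"
    using iid by (auto simp: iid_def)
  have m[measurable]: "random_variable borel (\<epsilon> t)" for t
    using ind by (simp add: indep_vars_def)
  have tr: "expectation (\<lambda>\<omega>. g (\<epsilon> t \<omega>)) = expectation (\<lambda>\<omega>. g (\<epsilon> 0 \<omega>))"
    "integrable M (\<lambda>\<omega>. g (\<epsilon> t \<omega>)) \<longleftrightarrow> integrable M (\<lambda>\<omega>. g (\<epsilon> 0 \<omega>))"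
    if [measurable]: "g \<in> borel_measurable borel" for g :: "real \<Rightarrow> real" and t
    using integral_distr[OF m[of t] that] integral_distr[OF m[of 0] that]
      integrable_distr_eq[OF m[of t] that] integrable_distr_eq[OF m[of 0] that] unfolding d[of t] by auto
  have sqt: "integrable M (\<lambda>\<omega>. (\<epsilon> t \<omega>)\<^sup>2)" for t
    using tr(2)[of "\<lambda>x. x\<^sup>2" t] sq by simp
  have mt: "expectation (\<epsilon> t) = 0" for t
    using tr(1)[of "\<lambda>x. x" t] mean by simp
  have it: "integrable M (\<epsilon> t)" for t by (rule integrable_of_square[OF m sqt])
  have "expectation (\<lambda>\<omega>. \<epsilon> s \<omega> * \<epsilon> t \<omega>) = (if s = t then variance (\<epsilon> 0) else 0)" for s t
  proof (cases "s = t")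
    case True
    thus ?thesis using tr(1)[of "\<lambda>x. x\<^sup>2" t] mean by (simp add: power2_eq_square)
  next
    case False
    have "indep_vars (\<lambda>_. borel) \<epsilon> {s, t}" by (rule indep_vars_subset[OF ind]) simp
    from indep_vars_lebesgue_integral[OF _ this it]
    have "expectation (\<lambda>\<omega>. \<Prod>i\<in>{s, t}. \<epsilon> i \<omega>) = (\<Prod>i\<in>{s, t}. expectation (\<epsilon> i))" by simp
    thus ?thesis using False by (simp add: mt)
  qed
  thus ?thesis using m sqt mt by (simp add: white_noise_def)
qed

text \<open>
  The index set is arbitrary so that differences of partial sums have the same form.
\<close>
definition partial_linear :: "(nat \<Rightarrow> real) \<Rightarrow> (int \<Rightarrow> 'a \<Rightarrow> real) \<Rightarrow> nat set \<Rightarrow> int \<Rightarrow> 'a \<Rightarrow> real" where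
  "partial_linear a \<epsilon> J t \<omega> = (\<Sum>j\<in>J. a j * \<epsilon> (t - int j) \<omega>)"

lemma (in prob_space) white_noise_partial_linear:
  assumes wn: "white_noise v \<epsilon>"
  shows "random_variable borel (partial_linear a \<epsilon> J t)"
    and "integrable M (\<lambda>\<omega>. (partial_linear a \<epsilon> J t \<omega>)\<^sup>2)"
    and "expectation (partial_linear a \<epsilon> J t) = 0"
    and "expectation (\<lambda>\<omega>. partial_linear a \<epsilon> J s \<omega> * partial_linear a \<epsilon> K t \<omega>)
      = (\<Sum>j\<in>J. \<Sum>k\<in>K. a j * a k * (if s - int j = t - int k then v else 0))"
proof -
  have m[measurable]: "\<And>t. random_variable borel (\<epsilon> t)" and sq: "\<And>t. integrable M (\<lambda>\<omega>. (\<epsilon> t \<omega>)\<^sup>2)"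
    and e0: "\<And>t. expectation (\<epsilon> t) = 0"
    and cov: "\<And>s t. expectation (\<lambda>\<omega>. \<epsilon> s \<omega> * \<epsilon> t \<omega>) = (if s = t then v else 0)"
    using wn by (auto simp: white_noise_def)
  have i1: "integrable M (\<epsilon> t)" for t by (rule integrable_of_square[OF m sq])
  have i2: "integrable M (\<lambda>\<omega>. \<epsilon> s \<omega> * \<epsilon> t \<omega>)" for s t by (intro integrable_mult_of_square m sq)
  have prod: "partial_linear a \<epsilon> J s \<omega> * partial_linear a \<epsilon> K t \<omega>
      = (\<Sum>j\<in>J. \<Sum>k\<in>K. a j * a k * (\<epsilon> (s - int j) \<omega> * \<epsilon> (t - int k) \<omega>))" for s t J K \<omega>
    unfolding partial_linear_def sum_product by (simp add: mult_ac)
  have i3: "integrable M (\<lambda>\<omega>. a j * a k * (\<epsilon> s \<omega> * \<epsilon> t \<omega>))" for j k s t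
    by (intro integrable_mult_right i2)
  show "random_variable borel (partial_linear a \<epsilon> J t)"
    unfolding partial_linear_def by measurable
  show "integrable M (\<lambda>\<omega>. (partial_linear a \<epsilon> J t \<omega>)\<^sup>2)"
    unfolding power2_eq_square prod by (intro Bochner_Integration.integrable_sum i3)
  show "expectation (partial_linear a \<epsilon> J t) = 0"
    unfolding partial_linear_def using i1 by (simp add: e0)
  show "expectation (\<lambda>\<omega>. partial_linear a \<epsilon> J s \<omega> * partial_linear a \<epsilon> K t \<omega>)
      = (\<Sum>j\<in>J. \<Sum>k\<in>K. a j * a k * (if s - int j = t - int k then v else 0))"
    unfolding prod using integral_double_sum[OF i3] by (simp only: integral_mult_right_zero cov)
qed

text \<open>
  The partial sums form a mean-square Cauchy sequence with error \<open>v\<close> times the tail of \<open>\<Sum> a\<^sub>j\<^sup>2\<close>, so the almost sure limit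
  is also a mean-square limit. The covariance is left as a limit of finite double sums: this form does not depend on
  \<open>t\<close>, and it is also what the Fourier coefficients of the squared transfer function reduce to.
\<close>
lemma (in prob_space) linear_process_second_order:
  assumes wn: "white_noise v \<epsilon>" and lp: "linear_process \<mu> a \<epsilon> Y" and a2: "summable (\<lambda>j. (a j)\<^sup>2)"
  shows "integrable M (\<lambda>\<omega>. (Y t \<omega>)\<^sup>2)" and "expectation (Y t) = \<mu>"
    and "(\<lambda>N. \<Sum>j<N. \<Sum>k<N. a j * a k * (if int k = h + int j then v else 0)) \<longlonglongrightarrow> covariance (Y t) (Y (t + h))"
proof -
  have v: "v \<ge> 0"
  proof -
    have "expectation (\<lambda>\<omega>. \<epsilon> 0 \<omega> * \<epsilon> 0 \<omega>) = v" using wn by (simp add: white_noise_def)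
    moreover have "expectation (\<lambda>\<omega>. \<epsilon> 0 \<omega> * \<epsilon> 0 \<omega>) \<ge> 0" by (intro Bochner_Integration.integral_nonneg) simp
    ultimately show ?thesis by simp
  qed
  define S where "S t N = partial_linear a \<epsilon> {..<N} t" for t N
  define Z where "Z t \<omega> = Y t \<omega> - \<mu>" for t \<omega>
  have Y[measurable]: "random_variable borel (Y t)" for t using lp by (simp add: linear_process_def)
  have Z[measurable]: "random_variable borel (Z t)" for t unfolding Z_def by measurable
  have S[measurable]: "random_variable borel (S t N)" for t N
    unfolding S_def by (rule white_noise_partial_linear[OF wn])
  have Ssq: "integrable M (\<lambda>\<omega>. (S t N \<omega>)\<^sup>2)" for t N
    unfolding S_def by (rule white_noise_partial_linear[OF wn])
  define \<eta> where "\<eta> n = v * ((\<Sum>j. (a j)\<^sup>2) - (\<Sum>j<n. (a j)\<^sup>2))" for n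
  have "\<eta> \<longlonglongrightarrow> v * ((\<Sum>j. (a j)\<^sup>2) - (\<Sum>j. (a j)\<^sup>2))"
    unfolding \<eta>_def by (intro tendsto_intros summable_LIMSEQ a2)
  hence \<eta>: "\<eta> \<longlonglongrightarrow> 0" by simp
  have cauchy: "expectation (\<lambda>\<omega>. (S t m \<omega> - S t n \<omega>)\<^sup>2) \<le> \<eta> n" if "m \<ge> n" for t m n
  proof -
    have split: "{..<m} = {..<n} \<union> {n..<m}" using that by auto
    have "S t m \<omega> - S t n \<omega> = partial_linear a \<epsilon> {n..<m} t \<omega>" for \<omega>
      unfolding S_def partial_linear_def split by (subst sum.union_disjoint) auto
    hence "expectation (\<lambda>\<omega>. (S t m \<omega> - S t n \<omega>)\<^sup>2) =
        (\<Sum>j\<in>{n..<m}. \<Sum>k\<in>{n..<m}. a j * a k * (if t - int j = t - int k then v else 0))"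
      by (simp add: power2_eq_square white_noise_partial_linear(4)[OF wn])
    also have "\<dots> = (\<Sum>j\<in>{n..<m}. \<Sum>k\<in>{n..<m}. if j = k then v * (a j)\<^sup>2 else 0)"
      by (intro sum.cong) (auto simp: power2_eq_square)
    also have "\<dots> = v * (\<Sum>j\<in>{n..<m}. (a j)\<^sup>2)" by (simp add: sum_distrib_left)
    also have "(\<Sum>j\<in>{n..<m}. (a j)\<^sup>2) = (\<Sum>j<m. (a j)\<^sup>2) - (\<Sum>j<n. (a j)\<^sup>2)"
      unfolding split by (subst sum.union_disjoint) auto
    also have "\<dots> \<le> (\<Sum>j. (a j)\<^sup>2) - (\<Sum>j<n. (a j)\<^sup>2)"
      using sum_le_suminf[OF a2, of "{..<m}"] by simp
    finally show ?thesis using v by (simp add: \<eta>_def mult_left_mono)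
  qed
  have AE: "AE \<omega> in M. (\<lambda>N. S t N \<omega>) \<longlonglongrightarrow> Z t \<omega>" for t
    using lp unfolding linear_process_def sums_def S_def Z_def partial_linear_def by blast
  note L2 = L2_limit_of_AE_limit[OF S Z Ssq cauchy AE]
  have Zsq: "integrable M (\<lambda>\<omega>. (Z t \<omega>)\<^sup>2)" for t by (rule L2(1))
  have L2lim: "(\<lambda>n. expectation (\<lambda>\<omega>. (Z t \<omega> - S t n \<omega>)\<^sup>2)) \<longlonglongrightarrow> 0" for t
    by (rule tendsto_sandwich[OF _ _ tendsto_const \<eta>]) (auto intro!: always_eventually L2(2))
  have "integrable M (\<lambda>\<omega>. (Z t \<omega> - (- \<mu>))\<^sup>2)" for t
    using Zsq by (intro integrable_square_diff) auto
  thus Ysq: "integrable M (\<lambda>\<omega>. (Y t \<omega>)\<^sup>2)" for t by (simp add: Z_def)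
  have Yi: "integrable M (Y t)" for t by (rule integrable_of_square[OF Y Ysq])
  have mean: "expectation (Y t) = \<mu>" for t
  proof -
    have "(\<lambda>n. expectation (\<lambda>\<omega>. S t n \<omega> * 1)) \<longlonglongrightarrow> expectation (\<lambda>\<omega>. Z t \<omega> * 1)"
      using L2lim by (intro L2_product_limit S Z Ssq Zsq) auto
    moreover have "expectation (\<lambda>\<omega>. S t n \<omega> * 1) = 0" for n
      unfolding S_def using white_noise_partial_linear(3)[OF wn] by simp
    ultimately have "expectation (Z t) = 0" by (simp add: LIMSEQ_const_iff)
    moreover have "Z t = (\<lambda>\<omega>. Y t \<omega> - \<mu>)" by (simp add: Z_def fun_eq_iff)
    ultimately show ?thesis using Yi[of t] by (simp add: prob_space)
  qed
  show "expectation (Y t) = \<mu>" by (rule mean)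
  have "(\<lambda>n. expectation (\<lambda>\<omega>. S t n \<omega> * S (t + h) n \<omega>)) \<longlonglongrightarrow> expectation (\<lambda>\<omega>. Z t \<omega> * Z (t + h) \<omega>)"
    by (intro L2_product_limit S Z Ssq Zsq L2lim)
  moreover have "expectation (\<lambda>\<omega>. S t n \<omega> * S (t + h) n \<omega>) =
      (\<Sum>j<n. \<Sum>k<n. a j * a k * (if int k = h + int j then v else 0))" for n
    unfolding S_def white_noise_partial_linear(4)[OF wn] by (intro sum.cong refl) auto
  ultimately show "(\<lambda>N. \<Sum>j<N. \<Sum>k<N. a j * a k * (if int k = h + int j then v else 0)) \<longlonglongrightarrow> covariance (Y t) (Y (t + h))"
    by (simp add: covariance_def mean Z_def)
qed

lemma (in prob_space) linear_process_covariance_stationary: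
  assumes "white_noise v \<epsilon>" "linear_process \<mu> a \<epsilon> Y" "summable (\<lambda>j. (a j)\<^sup>2)"
  shows "covariance_stationary Y"
proof -
  note so = linear_process_second_order[OF assms]
  have "covariance (Y t) (Y (t + h)) = covariance (Y 0) (Y h)" for t h
    using LIMSEQ_unique[OF so(3)[of h t] so(3)[of h 0]] by simp
  moreover have "random_variable borel (Y t)" for t using assms(2) by (simp add: linear_process_def)
  ultimately show ?thesis using so(1,2) by (simp add: covariance_stationary_def)
qed

lemma set_integral_cis:
  "(LINT x:{-pi..pi}|lebesgue. cis (of_int n * x)) = (if n = 0 then 2 * pi else 0)"
proof -
  have c: "continuous_on {-pi..pi} (\<lambda>x. cis (of_int n * x))" unfolding cis_conv_exp by (intro continuous_intros)
  have "((\<lambda>x. cis (of_int n * x)) has_integral (if n = 0 then 2 * pi else 0)) {-pi..pi}"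
  proof (cases "n = 0")
    case True
    thus ?thesis using has_integral_const_real[of "1 :: complex" "-pi" pi] by (simp add: scaleR_conv_of_real)
  next
    case False
    have "((\<lambda>x. cis (of_int n * x)) has_integral
        (cis (of_int n * pi) / (\<i> * of_int n) - cis (of_int n * (- pi)) / (\<i> * of_int n))) {-pi..pi}"
    proof (rule fundamental_theorem_of_calculus)
      fix x :: real
      have "((\<lambda>z. exp (\<i> * (of_int n * z)) / (\<i> * of_int n)) has_field_derivative
          (exp (\<i> * (of_int n * of_real x)) * (\<i> * of_int n)) / (\<i> * of_int n)) (at (of_real x))"
        by (rule DERIV_cdivide) (auto intro!: derivative_eq_intros simp: mult_ac)
      from has_vector_derivative_real_field[OF this]
      show "((\<lambda>x. cis (of_int n * x) / (\<i> * of_int n)) has_vector_derivative cis (of_int n * x)) (at x within {-pi..pi})"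
        using False by (simp add: cis_conv_exp)
    qed simp
    moreover have "sin (of_int n * pi) = 0" using sin_npi_int[of n] by (simp add: mult.commute)
    hence "cis (of_int n * pi) = cis (of_int n * (- pi))" by (simp add: complex_eq_iff)
    ultimately show ?thesis using False by simp
  qed
  thus ?thesis
    unfolding set_lebesgue_integral_eq_integral(2)[OF absolutely_integrable_continuous_real[OF c]]
    by (rule integral_unique)
qed

lemma continuous_on_transfer_function:
  assumes a: "summable (\<lambda>j. \<bar>a j\<bar>)"
  shows "continuous_on S (transfer_function a)"
proof -
  have "uniform_limit S (\<lambda>N x. \<Sum>j<N. of_real (a j) * cis (real j * x)) (transfer_function a) sequentially"
    unfolding transfer_function_def
    by (rule Weierstrass_m_test[OF _ a]) (simp add: norm_mult)
  thus ?thesis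
    by (rule uniform_limit_theorem[rotated])
      (auto intro!: always_eventually continuous_intros simp: cis_conv_exp)
qed

text \<open>
  For a finite sum, expand \<open>\<bar>A\<bar>\<^sup>2 = A \<cdot> cnj A\<close> and use the orthogonality of characters; the partial sums are bounded
  by \<open>\<Sum> \<bar>a\<^sub>j\<bar>\<close>, so dominated convergence applies.
\<close>
lemma transfer_function_fourier_coefficients:
  assumes a: "summable (\<lambda>j. \<bar>a j\<bar>)"
  shows "(\<lambda>N. complex_of_real (\<Sum>j<N. \<Sum>k<N. a j * a k * (if int k = h + int j then 2 * pi else 0)))
    \<longlonglongrightarrow> (LINT x:{-pi..pi}|lebesgue. exp (\<i> * of_int h * of_real x) * of_real ((cmod (transfer_function a x))\<^sup>2))"
proof -
  define A where "A N x = (\<Sum>j<N. complex_of_real (a j) * cis (real j * x))" for N x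
  let ?e = "\<lambda>x::real. exp (\<i> * of_int h * of_real x) :: complex"
  have s: "summable (\<lambda>j. complex_of_real (a j) * cis (real j * x))" for x
    by (rule summable_norm_cancel) (rule summable_transfer_function[OF a])
  have Alim: "(\<lambda>N. A N x) \<longlonglongrightarrow> transfer_function a x" for x
    unfolding A_def transfer_function_def by (rule summable_LIMSEQ[OF s])
  define T where "T = (\<Sum>j. \<bar>a j\<bar>)"
  have AT: "cmod (A N x) \<le> T" for N x
  proof -
    have "cmod (A N x) \<le> (\<Sum>j<N. \<bar>a j\<bar>)"
      unfolding A_def by (rule order_trans[OF norm_sum]) (simp add: norm_mult)
    also have "\<dots> \<le> T" unfolding T_def by (rule sum_le_suminf[OF a]) auto
    finally show ?thesis .
  qed
  have cA: "continuous_on S (A N)" for S N unfolding A_def cis_conv_exp by (intro continuous_intros)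
  have eq: "(LINT x:{-pi..pi}|lebesgue. ?e x * of_real ((cmod (A N x))\<^sup>2))
      = complex_of_real (\<Sum>j<N. \<Sum>k<N. a j * a k * (if int k = h + int j then 2 * pi else 0))" for N
  proof -
    have "?e x * of_real ((cmod (A N x))\<^sup>2)
        = (\<Sum>j<N. \<Sum>k<N. of_real (a j * a k) * cis (of_int (h + int j - int k) * x))" for x
    proof -
      have "?e x * of_real ((cmod (A N x))\<^sup>2) = ?e x * (A N x * cnj (A N x))"
        by (simp only: complex_norm_square)
      also have "\<dots> = (\<Sum>j<N. \<Sum>k<N. ?e x * ((of_real (a j) * cis (real j * x)) * (of_real (a k) * cis (- (real k * x)))))"
        unfolding A_def cnj_sum complex_cnj_mult complex_cnj_complex_of_real cis_cnj sum_product
        by (simp only: sum_distrib_left)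
      also have "\<dots> = (\<Sum>j<N. \<Sum>k<N. of_real (a j * a k) * cis (of_int (h + int j - int k) * x))"
      proof (intro sum.cong refl)
        fix j k
        have "?e x = cis (of_int h * x)" by (simp add: cis_conv_exp mult_ac)
        moreover have "cis (of_int (h + int j - int k) * x) = cis (of_int h * x) * cis (real j * x) * cis (- (real k * x))"
          by (simp add: cis_mult algebra_simps)
        ultimately show "?e x * ((of_real (a j) * cis (real j * x)) * (of_real (a k) * cis (- (real k * x))))
            = of_real (a j * a k) * cis (of_int (h + int j - int k) * x)"
          by (simp only: of_real_mult mult_ac)
      qed
      finally show ?thesis .
    qed
    hence "(LINT x:{-pi..pi}|lebesgue. ?e x * of_real ((cmod (A N x))\<^sup>2))
        = (LINT x:{-pi..pi}|lebesgue. (\<Sum>j<N. \<Sum>k<N. of_real (a j * a k) * cis (of_int (h + int j - int k) * x)))" by simp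
    also have "\<dots> = (\<Sum>j<N. \<Sum>k<N. LINT x:{-pi..pi}|lebesgue. of_real (a j * a k) * cis (of_int (h + int j - int k) * x))"
    proof -
      have "(\<lambda>x. complex_of_real (a j * a k) * cis (of_int (h + int j - int k) * x)) absolutely_integrable_on {-pi..pi}" for j k
        unfolding cis_conv_exp by (intro absolutely_integrable_continuous_real continuous_intros)
      thus ?thesis unfolding set_lebesgue_integral_def set_integrable_def scaleR_sum_right
        by (intro integral_double_sum)
    qed
    also have "\<dots> = (\<Sum>j<N. \<Sum>k<N. complex_of_real (a j * a k) * complex_of_real (if h + int j - int k = 0 then 2 * pi else 0))"
      by (simp only: set_integral_mult_right set_integral_cis)
    also have "\<dots> = complex_of_real (\<Sum>j<N. \<Sum>k<N. a j * a k * (if int k = h + int j then 2 * pi else 0))"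
      unfolding of_real_sum of_real_mult by (intro sum.cong refl) auto
    finally show ?thesis .
  qed
  have "(\<lambda>N. LINT x:{-pi..pi}|lebesgue. ?e x * of_real ((cmod (A N x))\<^sup>2))
      \<longlonglongrightarrow> (LINT x:{-pi..pi}|lebesgue. ?e x * of_real ((cmod (transfer_function a x))\<^sup>2))"
    unfolding set_lebesgue_integral_def
  proof (rule integral_dominated_convergence[where w = "\<lambda>x. indicator {-pi..pi} x *\<^sub>R T\<^sup>2"])
    have meas: "(\<lambda>x. indicator {-pi..pi} x *\<^sub>R (?e x * of_real ((cmod (F x))\<^sup>2))) \<in> borel_measurable lebesgue"
      if "continuous_on {-pi..pi} F" for F :: "real \<Rightarrow> complex"
    proof -
      have "(\<lambda>x. ?e x * of_real ((cmod (F x))\<^sup>2)) absolutely_integrable_on {-pi..pi}"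
        by (intro absolutely_integrable_continuous_real continuous_intros that)
      thus ?thesis unfolding set_integrable_def by (rule borel_measurable_integrable)
    qed
    show "(\<lambda>x. indicator {-pi..pi} x *\<^sub>R (?e x * of_real ((cmod (transfer_function a x))\<^sup>2))) \<in> borel_measurable lebesgue"
      by (intro meas continuous_on_transfer_function a)
    show "(\<lambda>x. indicator {-pi..pi} x *\<^sub>R (?e x * of_real ((cmod (A N x))\<^sup>2))) \<in> borel_measurable lebesgue" for N
      by (intro meas cA)
    show "integrable lebesgue (\<lambda>x. indicator {-pi..pi} x *\<^sub>R T\<^sup>2)"
      using absolutely_integrable_continuous_real[of "-pi" pi "\<lambda>_. T\<^sup>2"] by (simp add: set_integrable_def)
    show "AE x in lebesgue. (\<lambda>N. indicator {-pi..pi} x *\<^sub>R (?e x * of_real ((cmod (A N x))\<^sup>2)))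
        \<longlonglongrightarrow> indicator {-pi..pi} x *\<^sub>R (?e x * of_real ((cmod (transfer_function a x))\<^sup>2))"
      by (intro AE_I2 tendsto_intros Alim)
    show "AE x in lebesgue. norm (indicator {-pi..pi} x *\<^sub>R (?e x * of_real ((cmod (A N x))\<^sup>2))) \<le> indicator {-pi..pi} x *\<^sub>R T\<^sup>2" for N
      using AT by (intro AE_I2) (auto simp: indicator_def norm_mult norm_power intro!: power_mono)
  qed
  thus ?thesis unfolding eq .
qed

lemma summable_square_of_summable_abs:
  fixes a :: "nat \<Rightarrow> real"
  assumes a: "summable (\<lambda>j. \<bar>a j\<bar>)"
  shows "summable (\<lambda>j. (a j)\<^sup>2)"
proof (rule summable_comparison_test_ev[OF _ a])
  have "a \<longlonglongrightarrow> 0" by (rule summable_LIMSEQ_zero[OF summable_rabs_cancel[OF a]])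
  hence "\<forall>\<^sub>F j in sequentially. \<bar>a j\<bar> < 1" using tendstoD[of a 0 sequentially 1] by simp
  thus "\<forall>\<^sub>F j in sequentially. norm ((a j)\<^sup>2) \<le> \<bar>a j\<bar>"
  proof eventually_elim
    case (elim j)
    have "\<bar>a j\<bar> * \<bar>a j\<bar> \<le> \<bar>a j\<bar> * 1" using elim by (intro mult_left_mono) auto
    thus ?case by (simp add: power2_eq_square abs_mult)
  qed
qed

lemma (in prob_space) linear_process_spectral_density:
  assumes wn: "white_noise v \<epsilon>" and lp: "linear_process \<mu> a \<epsilon> Y" and v: "v \<ge> 0" and a: "summable (\<lambda>j. \<bar>a j\<bar>)"
  shows "spectral_density Y (\<lambda>x. v / (2 * pi) * (cmod (transfer_function a x))\<^sup>2)"
proof -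
  have a2: "summable (\<lambda>j. (a j)\<^sup>2)" by (rule summable_square_of_summable_abs[OF a])
  let ?f = "\<lambda>x. v / (2 * pi) * (cmod (transfer_function a x))\<^sup>2"
  have "complex_of_real (covariance (Y 0) (Y h)) = (LINT x:{-pi..pi}|lebesgue. exp (\<i> * of_int h * of_real x) * of_real (?f x))" for h
  proof -
    have "(\<lambda>N. of_real (v / (2 * pi)) * complex_of_real (\<Sum>j<N. \<Sum>k<N. a j * a k * (if int k = h + int j then 2 * pi else 0)))
        \<longlonglongrightarrow> of_real (v / (2 * pi)) * (LINT x:{-pi..pi}|lebesgue. exp (\<i> * of_int h * of_real x) * of_real ((cmod (transfer_function a x))\<^sup>2))"
      by (intro tendsto_mult tendsto_const transfer_function_fourier_coefficients a)
    moreover have "of_real (v / (2 * pi)) * complex_of_real (\<Sum>j<N. \<Sum>k<N. a j * a k * (if int k = h + int j then 2 * pi else 0))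
        = complex_of_real (\<Sum>j<N. \<Sum>k<N. a j * a k * (if int k = h + int j then v else 0))" for N
      unfolding of_real_mult[symmetric] sum_distrib_left
      by (intro arg_cong[where f = complex_of_real] sum.cong refl) auto
    moreover have "of_real (v / (2 * pi)) * (LINT x:{-pi..pi}|lebesgue. exp (\<i> * of_int h * of_real x) * of_real ((cmod (transfer_function a x))\<^sup>2))
        = (LINT x:{-pi..pi}|lebesgue. exp (\<i> * of_int h * of_real x) * of_real (?f x))"
      unfolding of_real_mult mult.left_commute[of "exp (\<i> * of_int h * of_real _)"]
      by (rule set_integral_mult_right[symmetric])
    ultimately have "(\<lambda>N. complex_of_real (\<Sum>j<N. \<Sum>k<N. a j * a k * (if int k = h + int j then v else 0)))
        \<longlonglongrightarrow> (LINT x:{-pi..pi}|lebesgue. exp (\<i> * of_int h * of_real x) * of_real (?f x))"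
      by (simp only:)
    moreover have "(\<lambda>N. complex_of_real (\<Sum>j<N. \<Sum>k<N. a j * a k * (if int k = h + int j then v else 0)))
        \<longlonglongrightarrow> of_real (covariance (Y 0) (Y (0 + h)))"
      by (intro tendsto_of_real linear_process_second_order(3)[OF wn lp a2])
    ultimately show ?thesis unfolding add_0_left by (rule LIMSEQ_unique[rotated])
  qed
  moreover have "?f absolutely_integrable_on {-pi..pi}"
    by (intro absolutely_integrable_continuous_real continuous_intros continuous_on_transfer_function a)
  ultimately show ?thesis using v by (simp add: spectral_density_def)
qed

section \<open>Linear processes with memory parameter minus one half\<close>

text \<open>
  The constant is \<open>v / (2\<pi>) \<cdot> 4\<pi> c\<^sup>2 = 2 v c\<^sup>2\<close>.
\<close>
lemma spectral_density_asymp: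
  assumes "memory_minus_half c a" "v > 0"
  shows "(\<lambda>x. v / (2 * pi) * (cmod (transfer_function a x))\<^sup>2) \<sim>[at 0] (\<lambda>x. 2 * v * c\<^sup>2 * \<bar>x\<bar>)"
proof (rule asymp_equivI'_const)
  have "((\<lambda>x. v / (2 * pi) * ((cmod (transfer_function a x))\<^sup>2 / \<bar>x\<bar>)) \<longlongrightarrow> v / (2 * pi) * (4 * pi * c\<^sup>2)) (at 0)"
    by (intro tendsto_mult tendsto_const transfer_function_asymp assms)
  thus "((\<lambda>x. v / (2 * pi) * (cmod (transfer_function a x))\<^sup>2 / \<bar>x\<bar>) \<longlongrightarrow> 2 * v * c\<^sup>2) (at 0)"
    by (simp add: field_simps)
  show "2 * v * c\<^sup>2 \<noteq> 0" using assms by (simp add: memory_minus_half_def)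
qed

lemma (in prob_space) linear_process_memory_minus_half:
  fixes Y \<epsilon> :: "int \<Rightarrow> 'a \<Rightarrow> real"
  assumes iid: "iid \<epsilon>" and fourth: "integrable M (\<lambda>\<omega>. (\<epsilon> 0 \<omega>) ^ 4)" and mean: "expectation (\<epsilon> 0) = 0"
    and var: "variance (\<epsilon> 0) = \<sigma>\<^sup>2" and pos: "\<sigma>\<^sup>2 > 0" and mem: "memory_minus_half c a"
    and lp: "linear_process \<mu> a \<epsilon> Y"
  shows "covariance_stationary Y \<and>
    (\<exists>f. spectral_density Y f \<and>
       (\<forall>g. spectral_density Y g \<longrightarrow> (AE x in lebesgue. x \<in> {-pi..pi} \<longrightarrow> g x = f x)) \<and>
       f \<sim>[at 0] (\<lambda>x. 2 * \<sigma>\<^sup>2 * c\<^sup>2 * \<bar>x\<bar>)) \<and>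
    (\<lambda>n. variance (\<lambda>\<omega>. \<Sum>t=1..n. Y (int t) \<omega>)) \<sim>[at_top] (\<lambda>n. 8 * \<sigma>\<^sup>2 * c\<^sup>2 * ln (real n))"
proof -
  define f where "f = (\<lambda>x. \<sigma>\<^sup>2 / (2 * pi) * (cmod (transfer_function a x))\<^sup>2)"
  have "random_variable borel (\<epsilon> 0)" using iid by (simp add: iid_def indep_vars_def)
  \<comment> \<open>On a probability space a finite fourth moment entails a finite second one.\<close>
  moreover have "integrable M (\<lambda>\<omega>. ((\<epsilon> 0 \<omega>)\<^sup>2)\<^sup>2)" using fourth by (simp flip: power_mult)
  ultimately have "integrable M (\<lambda>\<omega>. (\<epsilon> 0 \<omega>)\<^sup>2)" by (intro integrable_of_square[of "\<lambda>\<omega>. (\<epsilon> 0 \<omega>)\<^sup>2"]) auto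
  hence wn: "white_noise (\<sigma>\<^sup>2) \<epsilon>" using iid_white_noise[OF iid _ mean] unfolding var by blast
  have a: "summable (\<lambda>j. \<bar>a j\<bar>)" by (rule memory_minus_half_summable[OF mem])
  have cs: "covariance_stationary Y"
    by (rule linear_process_covariance_stationary[OF wn lp summable_square_of_summable_abs[OF a]])
  have sd: "spectral_density Y f"
    unfolding f_def using pos by (intro linear_process_spectral_density[OF wn lp _ a]) simp
  have fa: "f \<sim>[at 0] (\<lambda>x. 2 * \<sigma>\<^sup>2 * c\<^sup>2 * \<bar>x\<bar>)"
    unfolding f_def by (rule spectral_density_asymp[OF mem pos])
  have "2 * \<sigma>\<^sup>2 * c\<^sup>2 > 0" using pos mem by (simp add: memory_minus_half_def)
  from variance_sum_asymp[OF cs sd this fa]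
  have "(\<lambda>n. variance (\<lambda>\<omega>. \<Sum>t=1..n. Y (int t) \<omega>)) \<sim>[at_top] (\<lambda>n. 8 * \<sigma>\<^sup>2 * c\<^sup>2 * ln (real n))"
    by (simp add: mult.assoc)
  thus ?thesis using cs sd fa spectral_density_unique[OF sd] by blast
qed

theorem proposition2p1:
  fixes M :: "'a measure"
  assumes "prob_space M"
  shows
    "(\<forall>(Y :: int \<Rightarrow> 'a \<Rightarrow> real) (f :: real \<Rightarrow> real) (c\<^sub>f :: real).
        prob_space.covariance_stationary M Y \<longrightarrow>
        prob_space.spectral_density M Y f \<longrightarrow>
        c\<^sub>f > 0 \<longrightarrow>
        f \<sim>[at 0] (\<lambda>x. c\<^sub>f * \<bar>x\<bar>) \<longrightarrow>
        (\<lambda>n::nat. prob_space.variance M (\<lambda>\<omega>. \<Sum>t=1..n. Y (int t) \<omega>))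
          \<sim>[at_top] (\<lambda>n. 4 * c\<^sub>f * ln (real n)))
     \<and>
     (\<forall>(Y :: int \<Rightarrow> 'a \<Rightarrow> real) (\<epsilon> :: int \<Rightarrow> 'a \<Rightarrow> real) (a :: nat \<Rightarrow> real) (\<mu> :: real) (\<sigma> :: real) (c :: real).
        prob_space.iid M \<epsilon> \<longrightarrow>
        integrable M (\<lambda>\<omega>. (\<epsilon> 0 \<omega>) ^ 4) \<longrightarrow>
        prob_space.expectation M (\<epsilon> 0) = 0 \<longrightarrow>
        prob_space.variance M (\<epsilon> 0) = \<sigma>\<^sup>2 \<longrightarrow>
        \<sigma>\<^sup>2 > 0 \<longrightarrow>
        memory_minus_half c a \<longrightarrow>
        prob_space.linear_process M \<mu> a \<epsilon> Y \<longrightarrow>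
        prob_space.covariance_stationary M Y \<and>
        (\<exists>f. prob_space.spectral_density M Y f \<and>
             (\<forall>g. prob_space.spectral_density M Y g \<longrightarrow>
                  (AE x in lebesgue. x \<in> {-pi..pi} \<longrightarrow> g x = f x)) \<and>
             f \<sim>[at 0] (\<lambda>x. 2 * \<sigma>\<^sup>2 * c\<^sup>2 * \<bar>x\<bar>)) \<and>
        (\<lambda>n::nat. prob_space.variance M (\<lambda>\<omega>. \<Sum>t=1..n. Y (int t) \<omega>))
          \<sim>[at_top] (\<lambda>n. 8 * \<sigma>\<^sup>2 * c\<^sup>2 * ln (real n)))"
proof -
  interpret prob_space M by fact
  show ?thesis
    apply (rule conjI; intro allI impI)
    subgoal premises prems for Y f c using prems by (rule variance_sum_asymp)
    subgoal premises prems for Y \<epsilon> a \<mu> \<sigma> c using prems by (rule linear_process_memory_minus_half)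
    done
qed

end
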